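(* Let $r\geq 1$ and $n\geq 1$ be integers. For each $\sigma\in S_n$ and each multiset $X$ of elements of $[n]$ in which every element has multiplicity at most $r-1$, let $$b^r_{(\sigma,X)}:=\prod_{j\in \mathrm{Des}(\sigma)} z_{\{\sigma(1),\ldots,\sigma(j)\}}\cdot\prod_{j\in X} z_{\{\sigma(1),\ldots,\sigma(j)\}}\in T_n ,$$ where the second product is taken with multiplicity. (For $r=1$ the only choice is $X=\varnothing$, and the element is $\hat a_\sigma:=\prod_{j\in \mathrm{Des}(\sigma)} z_{\{\sigma(1),\ldots,\sigma(j)\}}$.) Then the family of cosets $b^r_{(\sigma,X)}+\overline{\mathrm{invar}(r,n)}$, indexed by all such pairs $(\sigma,X)$, is a $\mathbb{C}$-basis of $R_n/\overline{\mathrm{invar}(r,n)}\cong T_n/J_{r,n}$. The index pairs $(\sigma,X)$ are in bijection with the colored permutations $(\pi,\epsilon)\in\mathbb{Z}_r\wr S_n$, where $(\pi,\epsilon)$ corresponds to the pair $(\sigma,X)$ given by $X=\mathrm{NNeg}((\pi,\epsilon)^{-1})$ and $\sigma$ the unique element of $S_n$ with $(\pi,\epsilon)=(\rho,\delta)\circ(\sigma,(1,\ldots,1))$ for some $(\rho,\delta)\in\mathbb{Z}_r\wr S_n$ satisfying $\mathrm{Des}_A(\rho,\delta)=\varnothing$. Moreover, if $(\sigma,X)$ corresponds to $(\pi,\epsilon)$, then $b^r_{(\sigma,X)}$ encodes $\mathrm{ndes}(\pi,\epsilon)$ and $\mathrm{nmajor}(\pi,\epsilon)$: with respect to the bigrading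 $\deg(z_A)=t\,q^{|A|}$ on $T_n$, the monomial $b^r_{(\sigma,X)}$ has degree $t^{\mathrm{ndes}(\pi,\epsilon)}q^{\mathrm{nmajor}(\pi,\epsilon)}$.
   Context: Notation: $[n]=\{1,\ldots,n\}$. For $\sigma\in S_n$, $\mathrm{Des}(\sigma)=\{i\in[n-1]:\sigma(i)>\sigma(i+1)\}$. Algebras: $T_n=\mathbb{C}[z_A: A\subseteq[n]]$ is the polynomial ring in $2^n$ variables, $I_n=\langle z_Az_B-z_{A\cap B}z_{A\cup B} : A\not\subseteq B,\ B\not\subseteq A\rangle$, and $R_n=T_n/I_n$ (isomorphic to the semigroup algebra $\mathbb{C}[t\cdot\prod_{a\in A}x_a : A\subseteq[n]]\subset\mathbb{C}[t,x_1,\ldots,x_n]$ of the unit cube, via $z_A\mapsto t\prod_{a\in A}x_a$). Let $$\mathrm{invar}(r,n)=\Big\langle z_\varnothing,\ \sum_{A\subseteq[n],\,|A|=k}z_A^r \ (1\leq k\leq n)\Big\rangle\subset T_n,$$ let $\overline{\mathrm{invar}(r,n)}$ be its image in $R_n=T_n/I_n$, and let $J_{r,n}=\mathrm{invar}(r,n)+I_n$. Colored permutations: let $\omega=e^{2\pi i/r}$. Elements of $\mathbb{Z}_r\wr S_n$ are pairs $(\pi,\epsilon)$ with $\pi\in S_n$ and $\epsilon=(\epsilon_1,\ldots,\epsilon_n)$, $\epsilon_j=\omega^{c_j}$ with $c_j\in\{0,\ldots,r-1\}$; the pair is written $[\pi(1)^{c_1}\cdots\pi(n)^{c_n}]$.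 The product is $(\pi',\epsilon')\circ(\pi,\epsilon)=(\pi'\circ\pi,(\epsilon_1\epsilon'_{\pi(1)},\ldots,\epsilon_n\epsilon'_{\pi(n)}))$. Colored letters are totally ordered by $j^{c}<k^{d}$ iff $c>d$, or $c=d$ and $j<k$. Define - $\mathrm{Des}_A(\pi,\epsilon)=\{i\in[n-1]:\pi(i)^{c_i}>\pi(i+1)^{c_{i+1}}\}$; - $\mathrm{NNeg}(\pi,\epsilon)$ is the multiset on $[n]$ in which each $i$ appears exactly $c_i$ times; - $\mathrm{NDes}(\pi,\epsilon)=\mathrm{Des}_A(\pi,\epsilon)\cup\mathrm{NNeg}((\pi,\epsilon)^{-1})$ (multiset union, multiplicities added); - $\mathrm{ndes}(\pi,\epsilon)=\#\mathrm{NDes}(\pi,\epsilon)$ and $\mathrm{nmajor}(\pi,\epsilon)=\sum_{i\in\mathrm{NDes}(\pi,\epsilon)}i$, both counted with multiplicity. *)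

theory Defs
  imports
    Complex_Main
    "HOL-Library.Multiset"
    "HOL-Library.Poly_Mapping"
    "HOL-Combinatorics.Permutations"
    "HOL-Algebra.QuotRing"
    "HOL-Algebra.Embedded_Algebras"
begin

section \<open>The polynomial ring and its quotients\<close>

text \<open>
  Complex polynomials in variables indexed by sets of natural numbers: a monomial is a
  finitely supported exponent function, and the multiplication of
  \<^theory>\<open>HOL-Library.Poly_Mapping\<close> is convolution. The ring \<open>T\<^sub>n\<close> is the subring of those
  polynomials that involve only variables indexed by subsets of \<open>{1..n}\<close>.
\<close>

type_synonym zmonom = "nat set \<Rightarrow>\<^sub>0 nat"
type_synonym zpoly = "zmonom \<Rightarrow>\<^sub>0 complex"

definition zvar :: "nat set \<Rightarrow> zpoly" where
  "zvar A = Poly_Mapping.single (Poly_Mapping.single A 1) 1"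

definition zconst :: "complex \<Rightarrow> zpoly" where
  "zconst c = Poly_Mapping.single 0 c"

definition T_ring :: "nat \<Rightarrow> zpoly ring" where
  "T_ring n =
    \<lparr>carrier = {p. \<forall>m\<in>Poly_Mapping.keys p. Poly_Mapping.keys m \<subseteq> Pow {1..n}},
     mult = (*), one = 1, zero = 0, add = (+)\<rparr>"

definition I_ideal :: "nat \<Rightarrow> zpoly set" where
  "I_ideal n = Idl\<^bsub>T_ring n\<^esub>
    {zvar A * zvar B - zvar (A \<inter> B) * zvar (A \<union> B) | A B.
      A \<subseteq> {1..n} \<and> B \<subseteq> {1..n} \<and> \<not> A \<subseteq> B \<and> \<not> B \<subseteq> A}"

definition R_ring :: "nat \<Rightarrow> zpoly set ring" where
  "R_ring n = T_ring n Quot I_ideal n"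

definition invar :: "nat \<Rightarrow> nat \<Rightarrow> zpoly set" where
  "invar r n = Idl\<^bsub>T_ring n\<^esub>
    (insert (zvar {})
      {\<Sum>A | A \<subseteq> {1..n} \<and> card A = k. zvar A ^ r | k. 1 \<le> k \<and> k \<le> n})"

definition invar_bar :: "nat \<Rightarrow> nat \<Rightarrow> zpoly set set" where
  "invar_bar r n = (\<lambda>p. I_ideal n +>\<^bsub>T_ring n\<^esub> p) ` invar r n"

definition J_ideal :: "nat \<Rightarrow> nat \<Rightarrow> zpoly set" where
  "J_ideal r n = invar r n <+>\<^bsub>T_ring n\<^esub> I_ideal n"

definition Q_ring :: "nat \<Rightarrow> nat \<Rightarrow> zpoly set set ring" where
  "Q_ring r n = R_ring n Quot invar_bar r n"

definition Q_coset :: "nat \<Rightarrow> nat \<Rightarrow> zpoly \<Rightarrow> zpoly set set" where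
  "Q_coset r n p = invar_bar r n +>\<^bsub>R_ring n\<^esub> (I_ideal n +>\<^bsub>T_ring n\<^esub> p)"

text \<open>
  A quotient of \<open>T\<^sub>n\<close> is a complex algebra through the classes of the constant polynomials:
  multiplying by the scalar \<open>c\<close> is multiplying by the class of \<open>c\<close>.
\<close>

definition Q_scalars :: "nat \<Rightarrow> nat \<Rightarrow> zpoly set set set" where
  "Q_scalars r n = range (\<lambda>c. Q_coset r n (zconst c))"

text \<open>
  \<^const>\<open>ring.independent\<close> and \<^const>\<open>ring.Span\<close> are the library's notions for lists of vectors;
  a finite family is a basis if every repetition-free enumeration of it, as a list of
  vectors, is independent and spanning. Independence of the list includes
  injectivity of the family.
\<close>

definition is_basis_family ::
    "('a, 'b) ring_scheme \<Rightarrow> 'a set \<Rightarrow> 'i set \<Rightarrow> ('i \<Rightarrow> 'a) \<Rightarrow> bool" where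
  "is_basis_family R K I b \<longleftrightarrow> finite I \<and>
    (\<forall>xs. distinct xs \<and> set xs = I \<longrightarrow>
      ring.independent R K (map b xs) \<and> ring.Span R K (map b xs) = carrier R)"

section \<open>The basis elements\<close>

definition Des :: "nat \<Rightarrow> (nat \<Rightarrow> nat) \<Rightarrow> nat set" where
  "Des n \<sigma> = {i \<in> {1..n-1}. \<sigma> i > \<sigma> (i + 1)}"

definition index_pairs :: "nat \<Rightarrow> nat \<Rightarrow> ((nat \<Rightarrow> nat) \<times> nat multiset) set" where
  "index_pairs r n =
    {(\<sigma>, X). \<sigma> permutes {1..n} \<and> set_mset X \<subseteq> {1..n} \<and> (\<forall>j. count X j \<le> r - 1)}"

definition b_elem :: "nat \<Rightarrow> (nat \<Rightarrow> nat) \<times> nat multiset \<Rightarrow> zpoly" where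
  "b_elem n = (\<lambda>(\<sigma>, X).
    (\<Prod>j\<in>Des n \<sigma>. zvar (\<sigma> ` {1..j})) * (\<Prod>j\<in>#X. zvar (\<sigma> ` {1..j})))"

text \<open>The bidegree \<open>(a, b)\<close> stands for \<open>t\<^sup>a q\<^sup>b\<close>, where \<open>z\<^sub>A\<close> has degree \<open>t q\<^bsup>|A|\<^esup>\<close>.\<close>

definition bidegree :: "zmonom \<Rightarrow> nat \<times> nat" where
  "bidegree m =
    (\<Sum>A\<in>Poly_Mapping.keys m. Poly_Mapping.lookup m A,
     \<Sum>A\<in>Poly_Mapping.keys m. Poly_Mapping.lookup m A * card A)"

section \<open>Colored permutations\<close>

type_synonym colperm = "(nat \<Rightarrow> nat) \<times> (nat \<Rightarrow> complex)"

definition omega :: "nat \<Rightarrow> complex" where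
  "omega r = exp (2 * of_real pi * \<i> / of_nat r)"

text \<open>
  The tuple \<open>(\<epsilon>\<^sub>1, \<dots>, \<epsilon>\<^sub>n)\<close> is a function that is constantly 1 outside \<open>{1..n}\<close>,
  in the same way as a permutation of \<open>{1..n}\<close> is the identity outside.
\<close>

definition colperms :: "nat \<Rightarrow> nat \<Rightarrow> colperm monoid" where
  "colperms r n =
    \<lparr>carrier = {(\<pi>, \<epsilon>). \<pi> permutes {1..n} \<and>
        (\<forall>j\<in>{1..n}. \<exists>c<r. \<epsilon> j = omega r ^ c) \<and> (\<forall>j. j \<notin> {1..n} \<longrightarrow> \<epsilon> j = 1)},
     mult = (\<lambda>(\<pi>', \<epsilon>') (\<pi>, \<epsilon>). (\<pi>' \<circ> \<pi>, \<lambda>j. \<epsilon> j * \<epsilon>' (\<pi> j))),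
     one = (id, \<lambda>_. 1)\<rparr>"

definition color :: "nat \<Rightarrow> colperm \<Rightarrow> nat \<Rightarrow> nat" where
  "color r g j = (THE c. c < r \<and> snd g j = omega r ^ c)"

text \<open>The pair \<open>(j, c)\<close> is the colored letter \<open>j\<^sup>c\<close>.\<close>

definition letter_less :: "nat \<times> nat \<Rightarrow> nat \<times> nat \<Rightarrow> bool" where
  "letter_less = (\<lambda>(j, c) (k, d). c > d \<or> (c = d \<and> j < k))"

definition Des_A :: "nat \<Rightarrow> nat \<Rightarrow> colperm \<Rightarrow> nat set" where
  "Des_A r n g = {i \<in> {1..n-1}.
    letter_less (fst g (i + 1), color r g (i + 1)) (fst g i, color r g i)}"

definition NNeg :: "nat \<Rightarrow> nat \<Rightarrow> colperm \<Rightarrow> nat multiset" where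
  "NNeg r n g = (\<Sum>i\<in>{1..n}. replicate_mset (color r g i) i)"

definition NDes :: "nat \<Rightarrow> nat \<Rightarrow> colperm \<Rightarrow> nat multiset" where
  "NDes r n g = mset_set (Des_A r n g) + NNeg r n (inv\<^bsub>colperms r n\<^esub> g)"

definition ndes :: "nat \<Rightarrow> nat \<Rightarrow> colperm \<Rightarrow> nat" where
  "ndes r n g = size (NDes r n g)"

definition nmajor :: "nat \<Rightarrow> nat \<Rightarrow> colperm \<Rightarrow> nat" where
  "nmajor r n g = (\<Sum>i\<in>#NDes r n g. i)"

definition sorting_factor :: "nat \<Rightarrow> nat \<Rightarrow> colperm \<Rightarrow> (nat \<Rightarrow> nat) \<Rightarrow> bool" where
  "sorting_factor r n g \<sigma> \<longleftrightarrow> \<sigma> permutes {1..n} \<and>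
    (\<exists>h\<in>carrier (colperms r n).
      g = h \<otimes>\<^bsub>colperms r n\<^esub> (\<sigma>, \<lambda>_. 1) \<and> Des_A r n h = {})"

definition index_of :: "nat \<Rightarrow> nat \<Rightarrow> colperm \<Rightarrow> (nat \<Rightarrow> nat) \<times> nat multiset" where
  "index_of r n g =
    (THE \<sigma>. sorting_factor r n g \<sigma>, NNeg r n (inv\<^bsub>colperms r n\<^esub> g))"

end

theory Submission
  imports Defs "HOL-Library.Function_Algebras"
begin

text \<open>
  The quotient \<open>R\<^sub>n\<close> is replaced by its concrete model: under
  \<open>z\<^sub>A \<mapsto> t \<cdot> (\<Prod>a\<in>A. x\<^sub>a)\<close> it becomes the span of the monomials
  \<open>t\<^sup>m x\<^sup>v\<close> with \<open>0 \<le> v\<^sub>a \<le> m\<close> (lemma \<open>cube_map_kernel\<close>). In this model multiplication adds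
  exponent vectors, and the generators of \<open>invar\<close> are \<open>t\<close> and the polynomials
  \<open>t\<^sup>r e\<^sub>k(x\<^sub>1\<^sup>r, \<dots>, x\<^sub>n\<^sup>r)\<close> with \<open>e\<^sub>k\<close> elementary symmetric; they are called
  \<open>\<theta>\<^sub>0, \<dots>, \<theta>\<^sub>n\<close> below. The claim about the basis is a consequence of the stronger statement
  that the products \<open>b \<cdot> \<theta>\<^sup>\<alpha>\<close>, where \<open>b\<close> runs through the proposed basis elements and \<open>\<alpha>\<close> through
  all exponents, form a vector space basis of the whole model (lemma \<open>cube_vector_basis\<close>): the
  model is then free over \<open>\<complex>[\<theta>\<^sub>0, \<dots>, \<theta>\<^sub>n]\<close> with basis \<open>b\<close>, and the products with \<open>\<alpha> \<noteq> 0\<close> span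
  the ideal that \<open>\<theta>\<^sub>0, \<dots>, \<theta>\<^sub>n\<close> generate.

  The stronger statement holds because the change from the monomials \<open>t\<^sup>m x\<^sup>v\<close> to the products
  \<open>b \<cdot> \<theta>\<^sup>\<alpha>\<close> is unitriangular. An element of the family \<open>b\<close> is given by a permutation \<open>\<sigma>\<close> and a
  multiset \<open>X\<close>. The candidate for the leading term of \<open>b \<cdot> \<theta>\<^sup>\<alpha>\<close> arises if from each factor
  \<open>\<theta>\<^sub>k\<close> one picks the set \<open>{\<sigma>(1), \<dots>, \<sigma>(k)}\<close>. Two facts make this work.

  \<^item> Every exponent vector is the candidate of exactly one product (lemma \<open>lead_bij\<close>). Sort the
    coordinates \<open>v\<^sub>a\<close> decreasingly, ties by increasing index; this determines \<open>\<sigma>\<close>, and the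
    differences of consecutive values are positive at the descents of \<open>\<sigma>\<close>. Subtract 1 from these
    and divide the rest by \<open>r\<close>: the remainders give \<open>X\<close> and the quotients \<open>\<alpha>\<close>.

  \<^item> Every other term of the product is smaller than the candidate (lemma
    \<open>cube_vector_triangular\<close>). Smaller means smaller \<open>(n + 1)|v|\<^sup>2 - 2 (\<Sum>a. a v\<^sub>a)\<close>, up to a
    summand that the bidegree determines. If \<open>u\<close> is the exponent of \<open>b\<close> and \<open>s\<close> the sum of the
    picks, the part of its value at \<open>u + s\<close> that is linear in \<open>s\<close> is twice the pairing of \<open>s\<close> with
    \<open>y\<^sub>a = (n + 1) u\<^sub>a - a\<close>. As \<open>y\<close> decreases strictly along \<open>\<sigma>\<close>, a set of size \<open>k\<close> pairs best with
    it exactly if it is \<open>{\<sigma>(1), \<dots>, \<sigma>(k)}\<close>; and \<open>|s|\<^sup>2\<close> is largest if the picks form a chain.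

  For colored permutations the same sorting lemma is used: sorting the colored letters of \<open>(\<pi>, \<epsilon>)\<close>
  determines \<open>\<sigma>\<close>, and the colors that the letters carry determine \<open>X\<close> and conversely.
\<close>

section \<open>Linear push-forward of polynomials along a map of monomials\<close>

definition pushforward :: "('a \<Rightarrow> 'b) \<Rightarrow> ('a \<Rightarrow>\<^sub>0 'c::comm_monoid_add) \<Rightarrow> ('b \<Rightarrow>\<^sub>0 'c)" where
  "pushforward f p = (\<Sum>m\<in>Poly_Mapping.keys p. Poly_Mapping.single (f m) (Poly_Mapping.lookup p m))"

lemma pushforward_superset:
  assumes "finite S" "Poly_Mapping.keys p \<subseteq> S"
  shows "pushforward f p = (\<Sum>m\<in>S. Poly_Mapping.single (f m) (Poly_Mapping.lookup p m))"
  unfolding pushforward_def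
  by (rule sum.mono_neutral_left) (use assms in \<open>auto simp: in_keys_iff\<close>)

lemma pushforward_add: "pushforward f (p + q) = pushforward f p + pushforward f q"
proof -
  let ?S = "Poly_Mapping.keys p \<union> Poly_Mapping.keys q"
  have "pushforward f (p + q) =
      (\<Sum>m\<in>?S. Poly_Mapping.single (f m) (Poly_Mapping.lookup (p + q) m))"
    by (rule pushforward_superset) (auto simp: keys_add)
  also have "\<dots> = (\<Sum>m\<in>?S. Poly_Mapping.single (f m) (Poly_Mapping.lookup p m)) +
      (\<Sum>m\<in>?S. Poly_Mapping.single (f m) (Poly_Mapping.lookup q m))"
    by (simp add: lookup_add single_add sum.distrib)
  also have "\<dots> = pushforward f p + pushforward f q"
    by (simp add: pushforward_superset[of ?S])
  finally show ?thesis .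
qed

lemma pushforward_zero [simp]: "pushforward f 0 = 0"
  by (simp add: pushforward_def)

lemma pushforward_single [simp]:
  "pushforward f (Poly_Mapping.single m c) = Poly_Mapping.single (f m) c"
  by (cases "c = 0") (simp_all add: pushforward_def)

lemma pushforward_sum: "pushforward f (sum g A) = (\<Sum>x\<in>A. pushforward f (g x))"
  by (induction A rule: infinite_finite_induct) (simp_all add: pushforward_add)

lemma pushforward_id: "pushforward (\<lambda>m. m) p = p"
proof (rule poly_mapping_eqI)
  fix k
  have "Poly_Mapping.lookup (pushforward (\<lambda>m. m) p) k =
      (\<Sum>m\<in>Poly_Mapping.keys p. if m = k then Poly_Mapping.lookup p m else 0)"
    unfolding pushforward_def lookup_sum by (rule sum.cong) (auto simp: lookup_single)
  then show "Poly_Mapping.lookup (pushforward (\<lambda>m. m) p) k = Poly_Mapping.lookup p k"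
    by (simp add: in_keys_iff)
qed

lemma sum_of_terms:
  "p = (\<Sum>m\<in>Poly_Mapping.keys p. Poly_Mapping.single m (Poly_Mapping.lookup p m))"
  using pushforward_id[of p] by (simp add: pushforward_def)

lemma pushforward_comp: "pushforward f (pushforward g p) = pushforward (\<lambda>m. f (g m)) p"
  by (subst (2) pushforward_def) (simp add: pushforward_sum, simp add: pushforward_def)

lemma pushforward_mult:
  fixes p q :: "'a::comm_monoid_add \<Rightarrow>\<^sub>0 'c::comm_semiring_0"
  assumes "\<And>a b. f (a + b) = f a + f b"
  shows "pushforward f (p * q) = pushforward f p * pushforward f q"
proof -
  have "p * q = (\<Sum>a\<in>Poly_Mapping.keys p. \<Sum>b\<in>Poly_Mapping.keys q.
      Poly_Mapping.single (a + b) (Poly_Mapping.lookup p a * Poly_Mapping.lookup q b))"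
    by (subst (1) sum_of_terms[of p], subst (1) sum_of_terms[of q])
      (simp add: sum_product mult_single)
  then show ?thesis
    by (simp add: pushforward_sum pushforward_def[of f p] pushforward_def[of f q]
        sum_product mult_single assms)
qed

section \<open>Ideals of the polynomial ring\<close>

lemma T_ring_simps [simp]:
  "mult (T_ring n) = (*)" "one (T_ring n) = 1" "zero (T_ring n) = 0" "add (T_ring n) = (+)"
  by (simp_all add: T_ring_def)

lemma in_T_iff:
  "p \<in> carrier (T_ring n) \<longleftrightarrow>
    (\<forall>m\<in>Poly_Mapping.keys p. Poly_Mapping.keys m \<subseteq> Pow {1..n})"
  by (simp add: T_ring_def)

lemma T_add: "p \<in> carrier (T_ring n) \<Longrightarrow> q \<in> carrier (T_ring n) \<Longrightarrow> p + q \<in> carrier (T_ring n)"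
  using keys_add[of p q] by (auto simp: in_T_iff)

lemma T_uminus: "p \<in> carrier (T_ring n) \<Longrightarrow> - p \<in> carrier (T_ring n)"
  by (simp add: in_T_iff in_keys_iff)

lemma T_diff: "p \<in> carrier (T_ring n) \<Longrightarrow> q \<in> carrier (T_ring n) \<Longrightarrow> p - q \<in> carrier (T_ring n)"
  using T_add[of p n "- q"] T_uminus[of q n] by simp

lemma T_mult: "p \<in> carrier (T_ring n) \<Longrightarrow> q \<in> carrier (T_ring n) \<Longrightarrow> p * q \<in> carrier (T_ring n)"
proof -
  assume a: "p \<in> carrier (T_ring n)" "q \<in> carrier (T_ring n)"
  show ?thesis unfolding in_T_iff
  proof
    fix m assume "m \<in> Poly_Mapping.keys (p * q)"
    then obtain a b where "m = a + b" "a \<in> Poly_Mapping.keys p" "b \<in> Poly_Mapping.keys q"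
      using keys_mult by blast
    then show "Poly_Mapping.keys m \<subseteq> Pow {1..n}"
      using a keys_add[of a b] by (fastforce simp: in_T_iff)
  qed
qed

lemma T_zero: "0 \<in> carrier (T_ring n)" and T_one: "1 \<in> carrier (T_ring n)"
  and T_const: "zconst c \<in> carrier (T_ring n)"
  by (simp_all add: in_T_iff zconst_def)

lemma T_zvar: "A \<subseteq> {1..n} \<Longrightarrow> zvar A \<in> carrier (T_ring n)"
  by (simp add: in_T_iff zvar_def)

lemma T_sum: "(\<And>x. x \<in> S \<Longrightarrow> f x \<in> carrier (T_ring n)) \<Longrightarrow> sum f S \<in> carrier (T_ring n)"
  by (induction S rule: infinite_finite_induct) (auto intro: T_add T_zero)

lemma T_prod_mset:
  "(\<And>x. x \<in># M \<Longrightarrow> f x \<in> carrier (T_ring n)) \<Longrightarrow> (\<Prod>x\<in>#M. f x) \<in> carrier (T_ring n)"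
  by (induction M) (auto intro: T_mult T_one)

lemma T_power: "p \<in> carrier (T_ring n) \<Longrightarrow> p ^ k \<in> carrier (T_ring n)"
  by (induction k) (auto intro: T_mult T_one)

lemma T_cring: "cring (T_ring n)"
proof (rule cringI)
  show "abelian_group (T_ring n)"
  proof (rule abelian_groupI)
    fix x assume "x \<in> carrier (T_ring n)"
    then show "\<exists>y\<in>carrier (T_ring n). y \<oplus>\<^bsub>T_ring n\<^esub> x = \<zero>\<^bsub>T_ring n\<^esub>"
      by (intro bexI[of _ "- x"]) (simp_all add: T_uminus)
  qed (auto simp: T_add T_zero algebra_simps)
  show "comm_monoid (T_ring n)"
    by unfold_locales (auto simp: T_mult T_one algebra_simps)
qed (auto simp: algebra_simps)

lemma T_is_ring: "ring (T_ring n)"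
  using T_cring by (rule cring.axioms)

lemma T_ideal_subset: "ideal J (T_ring n) \<Longrightarrow> a \<in> J \<Longrightarrow> a \<in> carrier (T_ring n)"
  by (rule ideal.Icarr)

lemma T_ideal_zero: "ideal J (T_ring n) \<Longrightarrow> 0 \<in> J"
  using additive_subgroup.zero_closed[OF ideal.axioms(1), of J "T_ring n"] by simp

lemma T_ideal_add: "ideal J (T_ring n) \<Longrightarrow> a \<in> J \<Longrightarrow> b \<in> J \<Longrightarrow> a + b \<in> J"
  using additive_subgroup.a_closed[OF ideal.axioms(1), of J "T_ring n" a b] by simp

lemma T_ideal_mult: "ideal J (T_ring n) \<Longrightarrow> a \<in> J \<Longrightarrow> t \<in> carrier (T_ring n) \<Longrightarrow> t * a \<in> J"
  using ideal.I_l_closed[of J "T_ring n" a t] by simp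

lemma T_ideal_uminus: "ideal J (T_ring n) \<Longrightarrow> a \<in> J \<Longrightarrow> - a \<in> J"
  using T_ideal_mult[of J n a "- 1"] T_uminus[OF T_one] by simp

lemma T_ideal_diff: "ideal J (T_ring n) \<Longrightarrow> a \<in> J \<Longrightarrow> b \<in> J \<Longrightarrow> a - b \<in> J"
  using T_ideal_add[of J n a "- b"] T_ideal_uminus[of J n b] by simp

lemma T_ideal_sum: "ideal J (T_ring n) \<Longrightarrow> (\<And>x. x \<in> S \<Longrightarrow> f x \<in> J) \<Longrightarrow> sum f S \<in> J"
  by (induction S rule: infinite_finite_induct) (auto intro: T_ideal_add T_ideal_zero)

lemma T_idealI:
  assumes "J \<subseteq> carrier (T_ring n)" "0 \<in> J" "\<And>a b. a \<in> J \<Longrightarrow> b \<in> J \<Longrightarrow> a + b \<in> J"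
    and "\<And>a t. a \<in> J \<Longrightarrow> t \<in> carrier (T_ring n) \<Longrightarrow> t * a \<in> J"
  shows "ideal J (T_ring n)"
proof (rule idealI[OF T_is_ring])
  have m: "- a \<in> J" if "a \<in> J" for a
    using assms(4)[OF that, of "- 1"] T_uminus[OF T_one] by simp
  have inv: "inv\<^bsub>add_monoid (T_ring n)\<^esub> a = - a" if "a \<in> J" for a
  proof -
    interpret R: ring "T_ring n" by (rule T_is_ring)
    have "\<ominus>\<^bsub>T_ring n\<^esub> a = - a"
      using that assms(1) T_uminus[of a n] by (intro R.minus_equality) auto
    then show ?thesis by (simp add: a_inv_def)
  qed
  show "subgroup J (add_monoid (T_ring n))"
    by unfold_locales (use assms inv m in auto)
qed (use assms(4) in \<open>auto simp: mult.commute\<close>)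

section \<open>The semigroup algebra of the unit cube\<close>

text \<open>
  Exponent vectors are functions on the natural numbers with pointwise addition. Coordinate 0 is the
  exponent of \<open>t\<close>, coordinate \<open>a\<close> that of \<open>x\<^sub>a\<close>; so \<open>t \<cdot> (\<Prod>a\<in>A. x\<^sub>a)\<close> has the exponent
  \<open>cube_point A\<close>.
\<close>

definition cube_point :: "nat set \<Rightarrow> nat \<Rightarrow> nat" where
  "cube_point A = (\<lambda>a. of_bool (a = 0 \<or> a \<in> A))"

definition exponent :: "zmonom \<Rightarrow> nat \<Rightarrow> nat" where
  "exponent m = (\<lambda>a. \<Sum>A\<in>Poly_Mapping.keys m. Poly_Mapping.lookup m A * cube_point A a)"

text \<open>
  The algebra homomorphism \<open>z\<^sub>A \<mapsto> t \<cdot> (\<Prod>a\<in>A. x\<^sub>a)\<close>.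
\<close>

definition cube_map :: "zpoly \<Rightarrow> (nat \<Rightarrow> nat) \<Rightarrow>\<^sub>0 complex" where
  "cube_map = pushforward exponent"

lemma exponent_add: "exponent (m + m') = exponent m + exponent m'"
proof
  fix a
  let ?S = "Poly_Mapping.keys m \<union> Poly_Mapping.keys m'"
  have *: "exponent k a = (\<Sum>A\<in>?S. Poly_Mapping.lookup k A * cube_point A a)"
    if "Poly_Mapping.keys k \<subseteq> ?S" for k
    unfolding exponent_def
    by (rule sum.mono_neutral_left) (use that in \<open>auto simp: in_keys_iff\<close>)
  show "exponent (m + m') a = (exponent m + exponent m') a"
    using keys_add[of m m']
    by (simp add: * lookup_add sum.distrib algebra_simps)
qed

lemma exponent_zero [simp]: "exponent 0 = 0"
  by (simp add: exponent_def fun_eq_iff)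

lemma exponent_single [simp]: "exponent (Poly_Mapping.single A 1) = cube_point A"
  by (simp add: exponent_def fun_eq_iff)

lemma exponent_sum_mset: "exponent (\<Sum>x\<in>#M. f x) = (\<Sum>x\<in>#M. exponent (f x))"
  by (induction M) (simp_all add: exponent_add)

lemma cube_map_zero [simp]: "cube_map 0 = 0" and cube_map_add: "cube_map (p + q) = cube_map p + cube_map q"
  and cube_map_single [simp]: "cube_map (Poly_Mapping.single m c) = Poly_Mapping.single (exponent m) c"
  and cube_map_sum: "cube_map (sum f A) = (\<Sum>x\<in>A. cube_map (f x))"
  by (simp_all add: cube_map_def pushforward_add pushforward_sum)

lemma cube_map_mult: "cube_map (p * q) = cube_map p * cube_map q"
  unfolding cube_map_def by (rule pushforward_mult) (rule exponent_add)

lemma cube_map_one [simp]: "cube_map 1 = 1"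
  by (metis single_one cube_map_single exponent_zero)

lemma cube_map_const [simp]: "cube_map (zconst c) = Poly_Mapping.single 0 c"
  by (simp add: zconst_def)

lemma cube_map_uminus: "cube_map (- p) = - cube_map p"
  using cube_map_add[of p "- p"] by (simp add: eq_neg_iff_add_eq_0 add.commute)

lemma cube_map_diff: "cube_map (p - q) = cube_map p - cube_map q"
  using cube_map_add[of p "- q"] by (simp add: cube_map_uminus)

lemma cube_map_prod_mset: "cube_map (\<Prod>x\<in>#M. f x) = (\<Prod>x\<in>#M. cube_map (f x))"
  by (induction M) (simp_all add: cube_map_mult)

lemma cube_map_zvar: "cube_map (zvar A) = Poly_Mapping.single (cube_point A) 1"
  unfolding zvar_def by (simp only: cube_map_single exponent_single)

subsection \<open>Straightening and the kernel\<close>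

abbreviation zmon :: "nat set multiset \<Rightarrow> zpoly" where
  "zmon M \<equiv> (\<Prod>A\<in>#M. zvar A)"

abbreviation exps :: "nat set multiset \<Rightarrow> nat \<Rightarrow> nat" where
  "exps M \<equiv> (\<Sum>A\<in>#M. cube_point A)"

lemma single_sum_mset:
  "Poly_Mapping.single (\<Sum>x\<in>#M. f x) (1::complex) = (\<Prod>x\<in>#M. Poly_Mapping.single (f x) 1)"
proof (induction M)
  case (add x M)
  have "Poly_Mapping.single (f x + (\<Sum>x\<in>#M. f x)) (1::complex) =
      Poly_Mapping.single (f x) 1 * Poly_Mapping.single (\<Sum>x\<in>#M. f x) 1"
    by (simp add: mult_single)
  with add show ?case by simp
qed simp

lemma zmon_eq_single: "zmon M = Poly_Mapping.single (\<Sum>A\<in>#M. Poly_Mapping.single A 1) 1"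
  by (simp add: zvar_def single_sum_mset)

lemma cube_map_zmon: "cube_map (zmon M) = Poly_Mapping.single (exps M) 1"
  by (simp add: zmon_eq_single exponent_sum_mset del: single_one One_nat_def)

lemma monomial_as_multiset:
  fixes m :: "'a \<Rightarrow>\<^sub>0 nat"
  obtains M where "m = (\<Sum>A\<in>#M. Poly_Mapping.single A 1)" "set_mset M = Poly_Mapping.keys m"
proof
  let ?M = "\<Sum>A\<in>Poly_Mapping.keys m. replicate_mset (Poly_Mapping.lookup m A) A"
  have 1: "(\<Sum>A\<in>#(\<Sum>B\<in>S. replicate_mset (Poly_Mapping.lookup m B) B). Poly_Mapping.single A (1::nat)) =
      (\<Sum>B\<in>S. Poly_Mapping.single B (Poly_Mapping.lookup m B))" if "finite S" for S
    using that
  proof (induction S)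
    case (insert B S)
    have "(\<Sum>A\<in>#replicate_mset k B. Poly_Mapping.single A (1::nat)) = Poly_Mapping.single B k" for k
      by (induction k) (simp_all add: single_add[symmetric])
    with insert show ?case by simp
  qed simp
  show "m = (\<Sum>A\<in>#?M. Poly_Mapping.single A 1)"
    unfolding 1[OF finite_keys] by (rule sum_of_terms)
  show "set_mset ?M = Poly_Mapping.keys m"
    by (auto simp: set_mset_sum in_keys_iff split: if_splits)
qed

lemma I_ideal_ideal: "ideal (I_ideal n) (T_ring n)"
  unfolding I_ideal_def
  by (rule ring.genideal_ideal[OF T_is_ring]) (auto intro!: T_diff T_mult T_zvar)

lemma straightening_relation:
  assumes "A \<subseteq> {1..n}" "B \<subseteq> {1..n}"
  shows "zvar A * zvar B - zvar (A \<union> B) * zvar (A \<inter> B) \<in> I_ideal n"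
proof (cases "A \<subseteq> B \<or> B \<subseteq> A")
  case True
  then have "zvar A * zvar B - zvar (A \<union> B) * zvar (A \<inter> B) = 0"
    by (auto simp: Int_absorb1 Int_absorb2 Un_absorb1 Un_absorb2 mult.commute)
  then show ?thesis by (simp add: T_ideal_zero[OF I_ideal_ideal])
next
  case False
  then have "zvar A * zvar B - zvar (A \<inter> B) * zvar (A \<union> B) \<in> I_ideal n"
    unfolding I_ideal_def
    by (intro subsetD[OF ring.genideal_self[OF T_is_ring]])
      (use assms False in \<open>blast intro!: T_diff T_mult T_zvar\<close>)+
  then show ?thesis by (simp add: mult.commute)
qed

lemma cube_point_Un_Int: "cube_point (A \<union> B) + cube_point (A \<inter> B) = cube_point A + cube_point B"
  by (auto simp: cube_point_def fun_eq_iff)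

text \<open>
  One factor of a product of variables can be turned into the variable of the union of all index
  sets: after this has been done for all factors but one, \<open>z(A) z(B) = z(A \<union> B) z(A \<inter> B)\<close> brings in the last
  set. This straightens without an ordering of the monomials.
\<close>

lemma split_off_union:
  assumes "set_mset M \<subseteq> Pow {1..n}" "M \<noteq> {#}"
  shows "\<exists>M'. set_mset M' \<subseteq> Pow {1..n} \<and> zmon M - zvar (\<Union>(set_mset M)) * zmon M' \<in> I_ideal n \<and>
    exps M = cube_point (\<Union>(set_mset M)) + exps M'"
  using assms
proof (induction M)
  case (add A M)
  note I = I_ideal_ideal[of n]
  show ?case
  proof (cases "M = {#}")
    case True
    then show ?thesis by (intro exI[of _ "{#}"]) (simp add: T_ideal_zero[OF I])
  next
    case False
    define B where "B = \<Union>(set_mset M)"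
    from add False obtain M' where M': "set_mset M' \<subseteq> Pow {1..n}"
      "zmon M - zvar B * zmon M' \<in> I_ideal n" "exps M = cube_point B + exps M'"
      unfolding B_def by (metis set_mset_add_mset_insert insert_subset)
    have AB: "A \<subseteq> {1..n}" "B \<subseteq> {1..n}" using add.prems by (auto simp: B_def)
    have "zvar A * (zmon M - zvar B * zmon M') +
        zmon M' * (zvar A * zvar B - zvar (A \<union> B) * zvar (A \<inter> B)) \<in> I_ideal n"
      using M' AB
      by (intro T_ideal_add[OF I] T_ideal_mult[OF I] straightening_relation T_zvar T_prod_mset) auto
    then have "zvar A * zmon M - zvar (A \<union> B) * (zvar (A \<inter> B) * zmon M') \<in> I_ideal n"
      by (simp add: algebra_simps)
    moreover have "cube_point A + exps M = cube_point (A \<union> B) + (cube_point (A \<inter> B) + exps M')"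
      by (simp add: M'(3) add.assoc[symmetric] cube_point_Un_Int)
    ultimately show ?thesis
      using M'(1) AB
      by (intro exI[of _ "add_mset (A \<inter> B) M'"]) (auto simp: B_def)
  qed
qed simp

lemma exps_zero: "exps M 0 = size M"
  by (induction M) (simp_all add: cube_point_def)

lemma exps_pos: "a \<noteq> 0 \<Longrightarrow> exps M a > 0 \<longleftrightarrow> a \<in> \<Union>(set_mset M)"
  by (induction M) (auto simp: cube_point_def)

text \<open>
  The union of the index sets is the support of the exponent vector. So the factors split off from two
  products with the same exponent agree, and the remaining products again have the same exponent.
\<close>

lemma same_exponent_congruent:
  assumes "set_mset M \<subseteq> Pow {1..n}" "set_mset N \<subseteq> Pow {1..n}" "exps M = exps N"
  shows "zmon M - zmon N \<in> I_ideal n"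
  using assms
proof (induction "size M" arbitrary: M N)
  case 0
  have "size N = 0" using 0 by (metis exps_zero)
  with 0 show ?case by (simp add: T_ideal_zero[OF I_ideal_ideal])
next
  case (Suc k)
  note I = I_ideal_ideal[of n]
  have sz: "size N = Suc k" using Suc by (metis exps_zero)
  have ne: "M \<noteq> {#}" "N \<noteq> {#}" using Suc.hyps(2) sz by auto
  have z: "0 \<notin> \<Union>(set_mset M)" "0 \<notin> \<Union>(set_mset N)" using Suc.prems by fastforce+
  have U: "\<Union>(set_mset M) = \<Union>(set_mset N)"
    using exps_pos[of _ M] exps_pos[of _ N] z Suc.prems(3) by (metis subsetI subset_antisym)
  obtain M' where M': "set_mset M' \<subseteq> Pow {1..n}" "zmon M - zvar (\<Union>(set_mset M)) * zmon M' \<in> I_ideal n"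
    "exps M = cube_point (\<Union>(set_mset M)) + exps M'"
    using split_off_union[OF Suc.prems(1) ne(1)] by blast
  obtain N' where N': "set_mset N' \<subseteq> Pow {1..n}" "zmon N - zvar (\<Union>(set_mset M)) * zmon N' \<in> I_ideal n"
    "exps N = cube_point (\<Union>(set_mset M)) + exps N'"
    using split_off_union[OF Suc.prems(2) ne(2)] unfolding U by blast
  have "exps M' = exps N'" using M'(3) N'(3) Suc.prems(3) by (metis add_left_cancel)
  moreover have "size M' = k"
    using fun_cong[OF M'(3), of 0] Suc.hyps(2) unfolding plus_fun_apply exps_zero
    by (simp add: cube_point_def)
  ultimately have "zmon M' - zmon N' \<in> I_ideal n"
    using Suc.hyps(1) M'(1) N'(1) by blast
  then have "(zmon M - zvar (\<Union>(set_mset M)) * zmon M') + zvar (\<Union>(set_mset M)) * (zmon M' - zmon N')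
      - (zmon N - zvar (\<Union>(set_mset M)) * zmon N') \<in> I_ideal n"
    using Suc.prems(1)
    by (intro T_ideal_diff[OF I T_ideal_add[OF I M'(2) T_ideal_mult[OF I _ T_zvar]] N'(2)]) auto
  then show ?case by (simp add: algebra_simps)
qed

lemma cube_map_I_ideal:
  assumes "p \<in> I_ideal n" shows "cube_map p = 0"
proof -
  have "I_ideal n \<subseteq> {p \<in> carrier (T_ring n). cube_map p = 0}"
    unfolding I_ideal_def
  proof (rule ring.genideal_minimal[OF T_is_ring])
    show "ideal {p \<in> carrier (T_ring n). cube_map p = 0} (T_ring n)"
      by (rule T_idealI) (auto simp: cube_map_add cube_map_mult T_zero T_add T_mult)
    show "{zvar A * zvar B - zvar (A \<inter> B) * zvar (A \<union> B) |A B.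
        A \<subseteq> {1..n} \<and> B \<subseteq> {1..n} \<and> \<not> A \<subseteq> B \<and> \<not> B \<subseteq> A} \<subseteq> {p \<in> carrier (T_ring n). cube_map p = 0}"
    proof
      fix p assume "p \<in> {zvar A * zvar B - zvar (A \<inter> B) * zvar (A \<union> B) |A B.
        A \<subseteq> {1..n} \<and> B \<subseteq> {1..n} \<and> \<not> A \<subseteq> B \<and> \<not> B \<subseteq> A}"
      then obtain A B where p: "p = zvar A * zvar B - zvar (A \<inter> B) * zvar (A \<union> B)"
        and "A \<subseteq> {1..n}" "B \<subseteq> {1..n}" by blast
      moreover have "cube_point (A \<inter> B) + cube_point (A \<union> B) = cube_point A + cube_point B"
        using cube_point_Un_Int[of A B] by (simp add: add.commute)
      ultimately show "p \<in> {p \<in> carrier (T_ring n). cube_map p = 0}"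
        unfolding p by (auto intro!: T_diff T_mult T_zvar simp: cube_map_diff cube_map_mult cube_map_zvar mult_single)
    qed
  qed
  with assms show ?thesis by auto
qed

text \<open>
  Choose one monomial for each exponent vector and replace each monomial of \<open>p\<close> by the chosen monomial
  with its exponent. This changes \<open>p\<close> only by elements of the ideal, and the result depends linearly
  on the image of \<open>p\<close>, which is 0.
\<close>

theorem cube_map_kernel:
  assumes "p \<in> carrier (T_ring n)" "cube_map p = 0"
  shows "p \<in> I_ideal n"
proof -
  note I = I_ideal_ideal[of n]
  define lift where "lift w = (SOME m. exponent m = w \<and> Poly_Mapping.keys m \<subseteq> Pow {1..n})" for w
  have lift: "exponent (lift (exponent m)) = exponent m \<and> Poly_Mapping.keys (lift (exponent m)) \<subseteq> Pow {1..n}"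
    if "Poly_Mapping.keys m \<subseteq> Pow {1..n}" for m
    unfolding lift_def by (rule someI[of _ m]) (use that in auto)
  have *: "Poly_Mapping.single m c - Poly_Mapping.single (lift (exponent m)) c \<in> I_ideal n"
    if m: "Poly_Mapping.keys m \<subseteq> Pow {1..n}" for m c
  proof -
    obtain M where M: "m = (\<Sum>A\<in>#M. Poly_Mapping.single A 1)" "set_mset M = Poly_Mapping.keys m"
      by (rule monomial_as_multiset)
    obtain N where N: "lift (exponent m) = (\<Sum>A\<in>#N. Poly_Mapping.single A 1)"
      "set_mset N = Poly_Mapping.keys (lift (exponent m))"
      by (rule monomial_as_multiset)
    have "exps M = exps N"
      using lift[OF m] unfolding N(1) unfolding M(1)
      by (simp add: exponent_sum_mset del: One_nat_def)
    then have "zmon M - zmon N \<in> I_ideal n"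
      using lift[OF m] m M(2) N(2) by (intro same_exponent_congruent) auto
    then have "zconst c * (zmon M - zmon N) \<in> I_ideal n"
      by (intro T_ideal_mult[OF I] T_const)
    then show ?thesis
      by (simp add: zmon_eq_single M(1)[symmetric] N(1)[symmetric] zconst_def
          right_diff_distrib mult_single del: One_nat_def)
  qed
  have "pushforward (\<lambda>m. lift (exponent m)) p = pushforward lift (cube_map p)"
    by (simp add: cube_map_def pushforward_comp)
  also have "\<dots> = 0" by (simp add: assms(2))
  finally have "p = p - pushforward (\<lambda>m. lift (exponent m)) p" by simp
  also have "\<dots> = (\<Sum>m\<in>Poly_Mapping.keys p. Poly_Mapping.single m (Poly_Mapping.lookup p m) -
      Poly_Mapping.single (lift (exponent m)) (Poly_Mapping.lookup p m))"
    unfolding sum_subtractf pushforward_def by (subst (1) sum_of_terms[of p]) simp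
  also have "\<dots> \<in> I_ideal n"
    using assms(1) by (intro T_ideal_sum[OF I] *) (auto simp: in_T_iff)
  finally show ?thesis .
qed

section \<open>Sorting permutations\<close>

definition sorts :: "nat \<Rightarrow> (nat \<Rightarrow> nat) \<Rightarrow> (nat \<Rightarrow> nat) \<Rightarrow> bool" where
  "sorts n y \<sigma> \<longleftrightarrow> \<sigma> permutes {1..n} \<and> (\<forall>i\<in>{1..<n}. y (\<sigma> (i + 1)) < y (\<sigma> i))"

lemma sorts_less:
  assumes "sorts n y \<sigma>" "1 \<le> i" "i < j" "j \<le> n"
  shows "y (\<sigma> j) < y (\<sigma> i)"
  using assms(3,4)
proof (induction j)
  case (Suc j)
  have s: "y (\<sigma> (Suc j)) < y (\<sigma> j)"
    using assms(1,2) Suc.prems unfolding sorts_def by force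
  show ?case
  proof (cases "i = j")
    case False
    then have "y (\<sigma> j) < y (\<sigma> i)" using Suc by simp
    with s show ?thesis by simp
  qed (use s in simp)
qed simp

lemma sorts_less_iff:
  assumes "sorts n y \<sigma>" "i \<in> {1..n}" "j \<in> {1..n}"
  shows "y (\<sigma> j) < y (\<sigma> i) \<longleftrightarrow> i < j"
  using sorts_less[OF assms(1), of i j] sorts_less[OF assms(1), of j i] assms(2,3)
  by (cases i j rule: linorder_cases) auto

definition rank_from_top :: "nat \<Rightarrow> (nat \<Rightarrow> nat) \<Rightarrow> nat \<Rightarrow> nat" where
  "rank_from_top n y a = card {b \<in> {1..n}. y a \<le> y b}"

lemma rank_less:
  assumes "a \<in> {1..n}" "y a < y b"
  shows "rank_from_top n y b < rank_from_top n y a"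
  unfolding rank_from_top_def
proof (rule psubset_card_mono)
  have "a \<in> {b \<in> {1..n}. y a \<le> y b}" "a \<notin> {c \<in> {1..n}. y b \<le> y c}"
    using assms by auto
  then show "{c \<in> {1..n}. y b \<le> y c} \<subset> {c \<in> {1..n}. y a \<le> y c}"
    using assms(2) by fastforce
qed simp

lemma rank_inj:
  assumes "inj_on y {1..n}" shows "inj_on (rank_from_top n y) {1..n}"
proof (rule inj_onI)
  fix a b assume ab: "a \<in> {1..n}" "b \<in> {1..n}" "rank_from_top n y a = rank_from_top n y b"
  then have "y a = y b"
    using rank_less[of a n y b] rank_less[of b n y a] by (cases "y a" "y b" rule: linorder_cases) auto
  then show "a = b" using ab assms by (auto dest: inj_onD)
qed

text \<open>
  A sorting permutation is inverse to the rank function. This gives both its uniqueness and a way to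
  construct it.
\<close>

lemma rank_of_sorted:
  assumes "sorts n y \<sigma>" "i \<in> {1..n}"
  shows "rank_from_top n y (\<sigma> i) = i"
proof -
  have p: "\<sigma> permutes {1..n}" using assms(1) by (simp add: sorts_def)
  have "{b \<in> {1..n}. y (\<sigma> i) \<le> y b} = \<sigma> ` {1..i}"
  proof (intro equalityI subsetI)
    fix b assume b: "b \<in> {b \<in> {1..n}. y (\<sigma> i) \<le> y b}"
    then have "b \<in> \<sigma> ` {1..n}" using permutes_image[OF p] by simp
    then obtain j where j: "j \<in> {1..n}" "b = \<sigma> j" by blast
    then have "j \<le> i" using b sorts_less_iff[OF assms(1) assms(2) j(1)] by auto
    with j show "b \<in> \<sigma> ` {1..i}" by auto
  next
    fix b assume "b \<in> \<sigma> ` {1..i}"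
    then obtain j where j: "j \<in> {1..i}" "b = \<sigma> j" by blast
    have jn: "j \<in> {1..n}" using j assms(2) by auto
    then have "\<sigma> j \<in> {1..n}" using permutes_in_image[OF p] by simp
    then show "b \<in> {b \<in> {1..n}. y (\<sigma> i) \<le> y b}"
      using j sorts_less_iff[OF assms(1) jn assms(2)] sorts_less_iff[OF assms(1) assms(2) jn]
      by auto
  qed
  then show ?thesis
    using permutes_inj_on[OF p, of "{1..i}"] by (simp add: rank_from_top_def card_image)
qed

lemma sorts_unique:
  assumes "inj_on y {1..n}" "sorts n y \<sigma>" "sorts n y \<tau>"
  shows "\<sigma> = \<tau>"
proof
  fix i
  have p: "\<sigma> permutes {1..n}" "\<tau> permutes {1..n}" using assms by (simp_all add: sorts_def)
  show "\<sigma> i = \<tau> i"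
  proof (cases "i \<in> {1..n}")
    case True
    then show ?thesis
      using rank_of_sorted[OF assms(2) True] rank_of_sorted[OF assms(3) True]
        permutes_in_image[OF p(1)] permutes_in_image[OF p(2)] inj_onD[OF rank_inj[OF assms(1)]]
      by metis
  qed (use p in \<open>simp add: permutes_not_in\<close>)
qed

lemma sorts_exists:
  assumes "inj_on y {1..n}" shows "\<exists>\<sigma>. sorts n y \<sigma>"
proof -
  define f where "f a = (if a \<in> {1..n} then rank_from_top n y a else a)" for a
  have into: "rank_from_top n y a \<in> {1..n}" if "a \<in> {1..n}" for a
  proof -
    have "card {b \<in> {1..n}. y a \<le> y b} \<le> card {1..n}" by (rule card_mono) auto
    moreover have "card {b \<in> {1..n}. y a \<le> y b} > 0" using that by (auto simp: card_gt_0_iff)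
    ultimately show ?thesis by (simp add: rank_from_top_def)
  qed
  have "inj_on f {1..n} \<longleftrightarrow> inj_on (rank_from_top n y) {1..n}"
    by (rule inj_on_cong) (simp add: f_def)
  then have inj: "inj_on f {1..n}" using rank_inj[OF assms] by blast
  have "f ` {1..n} = {1..n}"
    by (rule endo_inj_surj) (use inj into in \<open>auto simp: f_def\<close>)
  then have f: "f permutes {1..n}"
    by (intro bij_imp_permutes) (use inj in \<open>auto simp: bij_betw_def f_def\<close>)
  define g where "g = inv_into UNIV f"
  have "sorts n y g"
    unfolding sorts_def
  proof (intro conjI ballI)
    show g: "g permutes {1..n}" unfolding g_def by (rule permutes_inv[OF f])
    fix i assume i: "i \<in> {1..<n}"
    have in1: "g i \<in> {1..n}" "g (i + 1) \<in> {1..n}"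
      using i permutes_in_image[OF g] by auto
    then have r: "rank_from_top n y (g i) = i" "rank_from_top n y (g (i + 1)) = i + 1"
      using permutes_inverses(1)[OF f, of i] permutes_inverses(1)[OF f, of "i + 1"]
      unfolding f_def g_def by metis+
    have "y (g i) \<noteq> y (g (i + 1))"
      using r in1 inj_onD[OF assms] by fastforce
    then show "y (g (i + 1)) < y (g i)"
      using rank_less[of "g i" n y "g (i + 1)"] r in1(1) by linarith
  qed
  then show ?thesis by blast
qed

text \<open>
  The order by \<open>w\<close>, ties broken in favour of the smaller index, as the order of a single number. With
  \<open>w\<close> as color this is the reverse of the order of the colored letters.
\<close>

definition letter_key :: "nat \<Rightarrow> (nat \<Rightarrow> nat) \<Rightarrow> nat \<Rightarrow> nat" where
  "letter_key n w a = (n + 1) * w a + (n + 1 - a)"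

lemma lex_less_iff:
  fixes a b c d m :: nat
  assumes "c < m" "d < m"
  shows "m * a + c < m * b + d \<longleftrightarrow> a < b \<or> a = b \<and> c < d"
proof (cases a b rule: linorder_cases)
  case less
  then have "m * (a + 1) \<le> m * b" by (intro mult_le_mono2) simp
  with less assms show ?thesis by simp
next
  case greater
  then have "m * (b + 1) \<le> m * a" by (intro mult_le_mono2) simp
  with greater assms show ?thesis by simp
qed simp

lemma letter_key_less:
  assumes "a \<in> {1..n}" "b \<in> {1..n}"
  shows "letter_key n w a < letter_key n w b \<longleftrightarrow> w a < w b \<or> w a = w b \<and> b < a"
  unfolding letter_key_def by (subst lex_less_iff) (use assms in auto)

lemma letter_key_inj: "inj_on (letter_key n w) {1..n}"
proof (rule inj_onI)
  fix a b assume "a \<in> {1..n}" "b \<in> {1..n}" "letter_key n w a = letter_key n w b"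
  then show "a = b" using letter_key_less[of a n b w] letter_key_less[of b n a w] by force
qed

section \<open>Exponent vectors of flags\<close>

definition cube_exponents :: "nat \<Rightarrow> (nat \<Rightarrow> nat) set" where
  "cube_exponents n = {w. (\<forall>a. w a \<le> w 0) \<and> (\<forall>a>n. w a = 0)}"

text \<open>
  The exponent of \<open>\<Prod>k\<le>n. z({\<sigma>(1), \<dots>, \<sigma>(k)}) ^ e k\<close>, a monomial supported on a flag.
\<close>

definition flag_exponent :: "nat \<Rightarrow> (nat \<Rightarrow> nat) \<Rightarrow> (nat \<Rightarrow> nat) \<Rightarrow> nat \<Rightarrow> nat" where
  "flag_exponent n \<sigma> e = (\<lambda>a. \<Sum>k\<le>n. e k * cube_point (\<sigma> ` {1..k}) a)"

lemma flag_exponent_zero: "flag_exponent n \<sigma> e 0 = (\<Sum>k\<le>n. e k)"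
  by (simp add: flag_exponent_def cube_point_def)

lemma flag_exponent_at:
  assumes "\<sigma> permutes {1..n}" "i \<in> {1..n}"
  shows "flag_exponent n \<sigma> e (\<sigma> i) = (\<Sum>k=i..n. e k)"
proof -
  have "\<sigma> i \<in> {1..n}" using assms permutes_in_image[OF assms(1)] by simp
  then have "\<sigma> i \<noteq> 0" by simp
  moreover have "\<sigma> i \<in> \<sigma> ` {1..k} \<longleftrightarrow> i \<le> k" for k
    using assms(2) permutes_inj[OF assms(1)] by (auto simp: inj_image_mem_iff)
  ultimately have "flag_exponent n \<sigma> e (\<sigma> i) = (\<Sum>k\<le>n. if i \<le> k then e k else 0)"
    unfolding flag_exponent_def cube_point_def by (intro sum.cong) auto
  also have "\<dots> = (\<Sum>k\<in>{i..n}. e k)"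
    by (rule sum.mono_neutral_cong_right) auto
  finally show ?thesis .
qed

lemma flag_exponent_beyond:
  assumes "\<sigma> permutes {1..n}" "a > n"
  shows "flag_exponent n \<sigma> e a = 0"
proof -
  have "a \<notin> \<sigma> ` {1..k}" if "k \<le> n" for k
    using that permutes_in_image[OF assms(1)] assms(2)
    by (metis atLeastAtMost_iff imageE le_trans not_le)
  then show ?thesis using assms(2) by (simp add: flag_exponent_def cube_point_def)
qed

lemma flag_exponent_step:
  assumes "\<sigma> permutes {1..n}" "i \<in> {1..<n}"
  shows "flag_exponent n \<sigma> e (\<sigma> i) = e i + flag_exponent n \<sigma> e (\<sigma> (i + 1))"
  using assms by (simp add: flag_exponent_at sum.atLeast_Suc_atMost)

lemma permutes_cases:
  fixes \<sigma> :: "nat \<Rightarrow> nat"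
  assumes "\<sigma> permutes {1..n}"
  obtains "a = 0" | i where "i \<in> {1..n}" "a = \<sigma> i" | "a > n"
proof -
  have "a = 0 \<or> a \<in> {1..n} \<or> a > n" by auto
  then have "a = 0 \<or> a \<in> \<sigma> ` {1..n} \<or> a > n" unfolding permutes_image[OF assms] .
  then show thesis using that by blast
qed

lemma flag_exponent_in_cube:
  assumes "\<sigma> permutes {1..n}"
  shows "flag_exponent n \<sigma> e \<in> cube_exponents n"
proof -
  have "flag_exponent n \<sigma> e a \<le> flag_exponent n \<sigma> e 0" for a
    by (rule permutes_cases[OF assms, of a])
      (auto simp: flag_exponent_zero flag_exponent_at[OF assms] flag_exponent_beyond[OF assms]
        intro!: sum_mono2)
  then show ?thesis
    using flag_exponent_beyond[OF assms] by (auto simp: cube_exponents_def)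
qed

lemma flag_exponent_cong:
  "(\<And>k. k \<le> n \<Longrightarrow> e k = e' k) \<Longrightarrow> flag_exponent n \<sigma> e = flag_exponent n \<sigma> e'"
  unfolding flag_exponent_def by (intro ext sum.cong) auto

text \<open>
  Along \<open>\<sigma>\<close> the coordinates fall by \<open>e k\<close> at step \<open>k\<close>. Where \<open>e k = 0\<close> there is a tie, which
  \<open>letter_key\<close> resolves as \<open>\<sigma>\<close> does, provided that \<open>\<sigma>\<close> ascends there.
\<close>

lemma flag_exponent_sorted:
  assumes "\<sigma> permutes {1..n}" "\<And>k. k \<in> Des n \<sigma> \<Longrightarrow> e k > 0"
  shows "sorts n (letter_key n (flag_exponent n \<sigma> e)) \<sigma>"
  unfolding sorts_def
proof (intro conjI ballI)
  fix i assume i: "i \<in> {1..<n}"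
  have m: "\<sigma> i \<in> {1..n}" "\<sigma> (i + 1) \<in> {1..n}"
    using i permutes_in_image[OF assms(1)] by auto
  have ne: "\<sigma> i \<noteq> \<sigma> (i + 1)" using permutes_inj[OF assms(1)] by (simp add: inj_eq)
  have "\<sigma> i < \<sigma> (i + 1) \<or> e i > 0"
    using assms(2)[of i] i ne unfolding Des_def by (cases "\<sigma> i < \<sigma> (i + 1)") auto
  then show "letter_key n (flag_exponent n \<sigma> e) (\<sigma> (i + 1)) < letter_key n (flag_exponent n \<sigma> e) (\<sigma> i)"
    unfolding letter_key_less[OF m(2,1)] flag_exponent_step[OF assms(1) i] by auto
qed (rule assms(1))

lemma flag_exponent_inj:
  assumes "n \<ge> 1" "\<sigma> permutes {1..n}" "flag_exponent n \<sigma> e = flag_exponent n \<sigma> e'" "k \<le> n"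
  shows "e k = e' k"
proof -
  note at = flag_exponent_at[OF assms(2)] and step = flag_exponent_step[OF assms(2)]
  consider "k = 0" | "k \<in> {1..<n}" | "k = n" using assms(4) by force
  then show ?thesis
  proof cases
    case 1
    have "(\<Sum>k\<le>n. f k) = f 0 + flag_exponent n \<sigma> f (\<sigma> 1)" for f
      using assms(1) by (simp add: at atMost_atLeast0 sum.atLeast_Suc_atMost)
    from this[of e] this[of e'] show ?thesis
      using assms(3) 1 by (metis add_right_cancel flag_exponent_zero)
  next
    case 2
    then show ?thesis using step[of k e] step[of k e'] assms(3) by simp
  next
    case 3
    then show ?thesis using at[of n e] at[of n e'] assms(1,3) by simp
  qed
qed

text \<open>
  Conversely \<open>e\<close> consists of the differences of consecutive coordinates. At a descent of \<open>\<sigma>\<close> the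
  index gets smaller, so the key can only fall because the coordinate does.
\<close>

lemma flag_exponent_surj:
  assumes "n \<ge> 1" "w \<in> cube_exponents n" "sorts n (letter_key n w) \<sigma>"
  obtains e where "w = flag_exponent n \<sigma> e" "\<And>k. k \<in> Des n \<sigma> \<Longrightarrow> e k > 0"
proof
  have p: "\<sigma> permutes {1..n}" using assms(3) by (simp add: sorts_def)
  define e where "e k = (if k = 0 then w 0 else w (\<sigma> k)) - (if k = n then 0 else w (\<sigma> (k + 1)))" for k
  have mem: "\<sigma> i \<in> {1..n}" if "i \<in> {1..n}" for i using that permutes_in_image[OF p] by simp
  have dec: "w (\<sigma> (i + 1)) < w (\<sigma> i) \<or> w (\<sigma> (i + 1)) = w (\<sigma> i) \<and> \<sigma> i < \<sigma> (i + 1)"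
    if "i \<in> {1..<n}" for i
  proof -
    have "letter_key n w (\<sigma> (i + 1)) < letter_key n w (\<sigma> i)"
      using assms(3) that unfolding sorts_def by blast
    then show ?thesis using letter_key_less[of "\<sigma> (i+1)" n "\<sigma> i" w] mem that by auto
  qed
  show "e k > 0" if "k \<in> Des n \<sigma>" for k
    using dec[of k] that by (fastforce simp: Des_def e_def)
  have tail: "(\<Sum>k=i..n. e k) = w (\<sigma> i)" if "1 \<le> i" "i \<le> n" for i
    using that(2,1)
  proof (induction i rule: inc_induct)
    case base
    then show ?case by (simp add: e_def)
  next
    case (step i)
    then show ?case using dec[of i]
      by (auto simp: sum.atLeast_Suc_atMost e_def)
  qed
  show "w = flag_exponent n \<sigma> e"
  proof
    fix a
    show "w a = flag_exponent n \<sigma> e a"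
    proof (rule permutes_cases[OF p, of a])
      assume a: "a = 0"
      have "w (\<sigma> 1) \<le> w 0" using assms(2) by (simp add: cube_exponents_def)
      then have "(\<Sum>k\<le>n. e k) = w 0"
        using assms(1) tail[of 1]
        by (simp add: atMost_atLeast0 sum.atLeast_Suc_atMost[of 0] e_def[of 0])
      then show ?thesis by (simp add: a flag_exponent_zero)
    next
      fix i assume "i \<in> {1..n}" "a = \<sigma> i"
      then show ?thesis using tail[of i] by (simp add: flag_exponent_at[OF p])
    next
      assume "n < a"
      then show ?thesis using assms(2) by (simp add: flag_exponent_beyond[OF p] cube_exponents_def)
    qed
  qed
qed

subsection \<open>Enumeration of the exponents of the cube algebra\<close>

text \<open>
  The power of the variables in the parameter of level \<open>k\<close>; on level 0 the parameter is \<open>z({})\<close> itself.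
\<close>

definition rho :: "nat \<Rightarrow> nat \<Rightarrow> nat" where
  "rho r k = (if k = 0 then 1 else r)"

text \<open>
  An index \<open>((\<sigma>, X), \<alpha>)\<close> stands for the product of the basis element of \<open>(\<sigma>, X)\<close> with the parameters
  of the levels in \<open>\<alpha>\<close>, counted with multiplicity. Its leading exponent picks
  \<open>{\<sigma>(1), \<dots>, \<sigma>(k)}\<close> from the parameter of level \<open>k\<close>.
\<close>

type_synonym index = "((nat \<Rightarrow> nat) \<times> nat multiset) \<times> nat multiset"

definition full_indices :: "nat \<Rightarrow> nat \<Rightarrow> index set" where
  "full_indices r n = index_pairs r n \<times> {\<alpha>. set_mset \<alpha> \<subseteq> {0..n}}"

definition lead :: "nat \<Rightarrow> nat \<Rightarrow> index \<Rightarrow> nat \<Rightarrow> nat" where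
  "lead r n = (\<lambda>((\<sigma>, X), \<alpha>).
    flag_exponent n \<sigma> (\<lambda>k. of_bool (k \<in> Des n \<sigma>) + count X k + rho r k * count \<alpha> k))"

text \<open>
  The vector determines \<open>\<sigma>\<close> by sorting, then the exponents \<open>e\<close> on the flag of \<open>\<sigma>\<close>; and
  \<open>e k - [k \<in> Des \<sigma>]\<close> is an arbitrary natural number, which division by \<open>r\<close> with remainder
  splits into the multiplicities of \<open>k\<close> in \<open>X\<close> and in \<open>\<alpha>\<close>. On level 0 all of \<open>e 0\<close> goes to \<open>\<alpha>\<close>.
\<close>

lemma lead_bij:
  assumes "r \<ge> 1" "n \<ge> 1"
  shows "bij_betw (lead r n) (full_indices r n) (cube_exponents n)"
  unfolding bij_betw_def
proof (intro conjI equalityI subsetI inj_onI)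
  let ?e = "\<lambda>\<sigma> X \<alpha> k. of_bool (k \<in> Des n \<sigma>) + count X k + rho r k * count \<alpha> k"
  fix x x' assume x: "x \<in> full_indices r n" "x' \<in> full_indices r n" and eq: "lead r n x = lead r n x'"
  obtain \<sigma> X \<alpha> where x1: "x = ((\<sigma>, X), \<alpha>)" by (metis prod.collapse)
  obtain \<sigma>' X' \<alpha>' where x2: "x' = ((\<sigma>', X'), \<alpha>')" by (metis prod.collapse)
  have p: "\<sigma> permutes {1..n}" "\<sigma>' permutes {1..n}"
    and X: "set_mset X \<subseteq> {1..n}" "set_mset X' \<subseteq> {1..n}" "\<And>j. count X j \<le> r - 1" "\<And>j. count X' j \<le> r - 1"
    and a: "set_mset \<alpha> \<subseteq> {0..n}" "set_mset \<alpha>' \<subseteq> {0..n}"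
    using x by (auto simp: x1 x2 full_indices_def index_pairs_def)
  have fe: "flag_exponent n \<sigma> (?e \<sigma> X \<alpha>) = flag_exponent n \<sigma>' (?e \<sigma>' X' \<alpha>')"
    using eq by (simp add: x1 x2 lead_def)
  have "sorts n (letter_key n (flag_exponent n \<sigma> (?e \<sigma> X \<alpha>))) \<sigma>"
    "sorts n (letter_key n (flag_exponent n \<sigma>' (?e \<sigma>' X' \<alpha>'))) \<sigma>'"
    by (rule flag_exponent_sorted; use p in simp)+
  then have s: "\<sigma> = \<sigma>'" unfolding fe by (rule sorts_unique[OF letter_key_inj])
  have e: "count X k + rho r k * count \<alpha> k = count X' k + rho r k * count \<alpha>' k" if "k \<le> n" for k
    using flag_exponent_inj[OF assms(2) p(1) fe[folded s] that] by simp
  have out: "count X k = 0 \<and> count X' k = 0" if "k = 0 \<or> k > n" for k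
    using X(1,2) that by (fastforce simp: not_in_iff[symmetric])
  have outa: "count \<alpha> k = 0 \<and> count \<alpha>' k = 0" if "k > n" for k
    using a that by (fastforce simp: not_in_iff[symmetric])
  have both: "count X k = count X' k \<and> count \<alpha> k = count \<alpha>' k" for k
  proof (cases "k = 0 \<or> k > n")
    case True
    then show ?thesis using e[of k] out[of k] outa[of k] by (auto simp: rho_def)
  next
    case False
    then have e': "count X k + r * count \<alpha> k = count X' k + r * count \<alpha>' k"
      using e[of k] by (simp add: rho_def)
    have lt: "count X k < r" "count X' k < r" using X(3,4)[of k] assms(1) by auto
    have "count X k = count X' k" using arg_cong[OF e', of "\<lambda>z. z mod r"] lt by simp
    with e' assms(1) show ?thesis by simp
  qed
  then have "X = X'" "\<alpha> = \<alpha>'" by (auto intro: multiset_eqI)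
  then show "x = x'" by (simp add: x1 x2 s)
next
  fix w assume "w \<in> lead r n ` full_indices r n"
  then show "w \<in> cube_exponents n"
    by (auto simp: lead_def full_indices_def index_pairs_def intro: flag_exponent_in_cube)
next
  fix w assume w: "w \<in> cube_exponents n"
  obtain \<sigma> where s: "sorts n (letter_key n w) \<sigma>" using sorts_exists[OF letter_key_inj] by blast
  then have p: "\<sigma> permutes {1..n}" by (simp add: sorts_def)
  obtain e where e: "w = flag_exponent n \<sigma> e" "\<And>k. k \<in> Des n \<sigma> \<Longrightarrow> e k > 0"
    using flag_exponent_surj[OF assms(2) w s] by blast
  define d where "d k = e k - of_bool (k \<in> Des n \<sigma>)" for k
  define X where "X = (\<Sum>k\<in>{1..n}. replicate_mset (d k mod r) k)"
  define \<alpha> where "\<alpha> = replicate_mset (e 0) 0 + (\<Sum>k\<in>{1..n}. replicate_mset (d k div r) k)"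
  have cX: "count X k = (if k \<in> {1..n} then d k mod r else 0)" for k
    by (simp add: X_def count_sum if_distrib cong: if_cong)
  have ca: "count \<alpha> k = (if k = 0 then e 0 else if k \<in> {1..n} then d k div r else 0)" for k
    by (simp add: \<alpha>_def count_sum if_distrib cong: if_cong)
  have "set_mset X \<subseteq> {1..n}" "set_mset \<alpha> \<subseteq> {0..n}"
    by (auto simp: set_mset_def cX ca split: if_splits)
  moreover have "count X j \<le> r - 1" for j
    using assms(1) mod_less_divisor[of r "d j"] by (auto simp: cX simp del: mod_less_divisor)
  ultimately have "((\<sigma>, X), \<alpha>) \<in> full_indices r n"
    using p by (simp add: full_indices_def index_pairs_def)
  moreover have "lead r n ((\<sigma>, X), \<alpha>) = w"
    unfolding lead_def e(1) prod.case
  proof (rule flag_exponent_cong)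
    fix k assume k: "k \<le> n"
    show "of_bool (k \<in> Des n \<sigma>) + count X k + rho r k * count \<alpha> k = e k"
    proof (cases "k = 0")
      case True
      then show ?thesis by (simp add: cX ca rho_def Des_def)
    next
      case False
      then have "count X k + rho r k * count \<alpha> k = d k"
        using k by (simp add: cX ca rho_def)
      then show ?thesis using e(2)[of k] by (auto simp: d_def)
    qed
  qed
  ultimately show "w \<in> lead r n ` full_indices r n" by (metis imageI)
qed

section \<open>Leading exponents of products of parameters\<close>

text \<open>
  The numbers \<open>n + 1 - a\<close> instead of \<open>-a\<close> keep the values natural. They add a multiple of the
  sum of the coordinates, which is constant on the terms of a homogeneous element.
\<close>

definition height :: "nat \<Rightarrow> (nat \<Rightarrow> nat) \<Rightarrow> nat" where
  "height n w = (\<Sum>a=1..n. (n + 1) * (w a)\<^sup>2 + 2 * (n + 1 - a) * w a)"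

text \<open>
  Meant for sums \<open>s\<close> and \<open>s'\<close> of indicator vectors of sets, where \<open>s'\<close> has the prefixes of \<open>\<sigma>\<close> of the
  same sizes in place of the sets of \<open>s\<close>.
  The first condition compares their pairings with indicator vectors; it is what an induction needs
  to bound the growth of \<open>|s|\<^sup>2\<close> when one more set is added.
\<close>

definition dominated :: "nat \<Rightarrow> (nat \<Rightarrow> nat) \<Rightarrow> (nat \<Rightarrow> nat) \<Rightarrow> (nat \<Rightarrow> nat) \<Rightarrow> bool" where
  "dominated n \<sigma> s s' \<longleftrightarrow> (\<forall>B\<subseteq>{1..n}. sum s B \<le> sum s' (\<sigma> ` {1..card B})) \<and>
     (\<Sum>a=1..n. (s a)\<^sup>2) \<le> (\<Sum>a=1..n. (s' a)\<^sup>2)"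

definition strictly_below :: "nat \<Rightarrow> (nat \<Rightarrow> nat) \<Rightarrow> (nat \<Rightarrow> nat) \<Rightarrow> (nat \<Rightarrow> nat) \<Rightarrow> (nat \<Rightarrow> nat) \<Rightarrow> bool" where
  "strictly_below n y \<sigma> s s' \<longleftrightarrow>
     dominated n \<sigma> s s' \<and> (\<Sum>a=1..n. y a * s a) < (\<Sum>a=1..n. y a * s' a)"

lemma permutes_prefix_subset:
  fixes \<sigma> :: "nat \<Rightarrow> nat"
  assumes "\<sigma> permutes {1..n}" "k \<le> n"
  shows "\<sigma> ` {1..k} \<subseteq> {1..n}"
proof -
  have "\<sigma> ` {1..k} \<subseteq> \<sigma> ` {1..n}" using assms(2) by (intro image_mono) simp
  then show ?thesis unfolding permutes_image[OF assms(1)] .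
qed

lemma card_le_bound: "A \<subseteq> {1..n} \<Longrightarrow> card A \<le> n"
  using card_mono[of "{1..n}" A] by simp

lemma sum_scaled_cube_point:
  assumes "B \<subseteq> {1..n}"
  shows "(\<Sum>a\<in>B. f a * (c * cube_point A a)) = c * sum f (A \<inter> B)"
proof -
  have fin: "finite B" using assms finite_subset by blast
  have "(\<Sum>a\<in>B. f a * (c * cube_point A a)) = (\<Sum>a\<in>B. if a \<in> A then c * f a else 0)"
    by (rule sum.cong) (use assms in \<open>auto simp: cube_point_def\<close>)
  also have "\<dots> = (\<Sum>a\<in>A \<inter> B. c * f a)"
    using fin by (simp add: sum.inter_restrict[symmetric] Int_commute)
  finally show ?thesis by (simp add: sum_distrib_left)
qed

lemma sum_cube_point: "B \<subseteq> {1..n} \<Longrightarrow> (\<Sum>a\<in>B. c * cube_point A a) = c * card (A \<inter> B)"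
  using sum_scaled_cube_point[of B n "\<lambda>_. 1"] by simp

text \<open>
  Both estimates reduce to \<open>|A \<inter> B| \<le> min |A| |B|\<close>, which is an equality for prefixes of \<open>\<sigma>\<close>.
\<close>

lemma dominated_step:
  assumes p: "\<sigma> permutes {1..n}" and "dominated n \<sigma> s s'" and A: "A \<subseteq> {1..n}"
  shows "dominated n \<sigma> (s + (\<lambda>a. c * cube_point A a)) (s' + (\<lambda>a. c * cube_point (\<sigma> ` {1..card A}) a))"
  unfolding dominated_def
proof (intro conjI allI impI)
  let ?S = "\<lambda>k. \<sigma> ` {1..k}"
  have S_sub: "?S k \<subseteq> {1..n}" if "k \<le> n" for k
    using that by (rule permutes_prefix_subset[OF p])
  have card_S: "card (?S k) = k" for k
    using permutes_inj_on[OF p] by (simp add: card_image)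
  have int_S: "?S k \<inter> ?S l = ?S (min k l)" for k l
    using permutes_inj[OF p] by (auto simp: inj_image_mem_iff image_Int[symmetric])
  fix B assume B: "B \<subseteq> {1..n}"
  have "sum s B \<le> sum s' (?S (card B))"
    using assms(2) B by (simp add: dominated_def)
  moreover have "card (A \<inter> B) \<le> card (?S (card A) \<inter> ?S (card B))"
    unfolding int_S card_S
    using A B by (simp add: card_mono finite_subset)
  ultimately show "sum (s + (\<lambda>a. c * cube_point A a)) B
      \<le> sum (s' + (\<lambda>a. c * cube_point (?S (card A)) a)) (?S (card B))"
    using sum_cube_point[OF B] sum_cube_point[OF S_sub[OF card_le_bound[OF B]]]
    by (simp add: sum.distrib add_mono)
next
  let ?S = "\<lambda>k. \<sigma> ` {1..k}"
  have S_sub: "?S (card A) \<subseteq> {1..n}"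
    by (rule permutes_prefix_subset[OF p card_le_bound[OF A]])
  have card_S: "card (?S k) = k" for k
    using permutes_inj_on[OF p] by (simp add: card_image)
  have sq: "(\<Sum>a=1..n. ((f + (\<lambda>a. c * cube_point B a)) a)\<^sup>2) =
      (\<Sum>a=1..n. (f a)\<^sup>2) + 2 * c * sum f B + c\<^sup>2 * card B" if B: "B \<subseteq> {1..n}" for f B
  proof -
    have "(\<Sum>a=1..n. ((f + (\<lambda>a. c * cube_point B a)) a)\<^sup>2) =
        (\<Sum>a=1..n. (f a)\<^sup>2 + f a * (2 * c * cube_point B a) + c\<^sup>2 * cube_point B a)"
      by (rule sum.cong) (auto simp: cube_point_def power2_eq_square algebra_simps)
    also have "\<dots> = (\<Sum>a=1..n. (f a)\<^sup>2) + 2 * c * sum f (B \<inter> {1..n}) + c\<^sup>2 * card (B \<inter> {1..n})"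
      unfolding sum.distrib by (simp only: sum_scaled_cube_point[OF subset_refl] sum_cube_point[OF subset_refl])
    finally show ?thesis using B by (simp add: Int_absorb2)
  qed
  have "sum s A \<le> sum s' (?S (card A))" "(\<Sum>a=1..n. (s a)\<^sup>2) \<le> (\<Sum>a=1..n. (s' a)\<^sup>2)"
    using assms(2) A by (auto simp: dominated_def)
  then show "(\<Sum>a=1..n. ((s + (\<lambda>a. c * cube_point A a)) a)\<^sup>2)
      \<le> (\<Sum>a=1..n. ((s' + (\<lambda>a. c * cube_point (?S (card A)) a)) a)\<^sup>2)"
    unfolding sq[OF A] sq[OF S_sub] card_S by (intro add_mono mult_left_mono) auto
qed

text \<open>
  Exchange argument: the elements that \<open>A\<close> lacks among the first \<open>|A|\<close> in the order of \<open>\<sigma>\<close> have larger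
  weights than those that it has instead, and there are equally many of both.
\<close>

lemma sum_top_greatest:
  assumes s: "sorts n y \<sigma>" and A: "A \<subseteq> {1..n}" "A \<noteq> \<sigma> ` {1..card A}"
  shows "sum y A < sum y (\<sigma> ` {1..card A})"
proof -
  have p: "\<sigma> permutes {1..n}" using s by (simp add: sorts_def)
  let ?k = "card A" let ?S = "\<sigma> ` {1..?k}"
  have k: "?k \<le> n" by (rule card_le_bound[OF A(1)])
  have fin: "finite A" "finite ?S" using A finite_subset by auto
  have cS: "card ?S = ?k" using permutes_inj_on[OF p] by (simp add: card_image)
  have "A \<noteq> {}" using A(2) by auto
  then have k1: "1 \<le> ?k" using fin(1) by (simp add: Suc_le_eq card_gt_0_iff)
  have kn: "?k \<in> {1..n}" using k k1 by simp
  have ge: "y (\<sigma> ?k) \<le> y b" if "b \<in> ?S" for b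
  proof -
    obtain i where i: "i \<in> {1..?k}" "b = \<sigma> i" using \<open>b \<in> ?S\<close> by blast
    then show ?thesis using sorts_less[OF s, of i ?k] k by (cases "i = ?k") auto
  qed
  have less: "y b < y (\<sigma> ?k)" if "b \<in> A - ?S" for b
  proof -
    have "b \<in> \<sigma> ` {1..n}" using that A(1) permutes_image[OF p] by auto
    then obtain i where i: "i \<in> {1..n}" "b = \<sigma> i" by blast
    then have "\<not> i \<le> ?k" using that by auto
    then show ?thesis using sorts_less[OF s k1, of i] i by simp
  qed
  have ne: "A - ?S \<noteq> {}"
  proof
    assume "A - ?S = {}"
    then have "A \<subseteq> ?S" by blast
    then show False using card_subset_eq[OF fin(2)] cS A(2) by simp
  qed
  have c: "card (A - ?S) = card (?S - A)"
    using card_Diff_subset_Int[of A ?S] card_Diff_subset_Int[of ?S A] fin cS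
    by (simp add: Int_commute)
  have "sum y (A - ?S) < (\<Sum>b\<in>A - ?S. y (\<sigma> ?k))"
    by (rule sum_strict_mono) (use fin ne less in auto)
  also have "\<dots> = (\<Sum>b\<in>?S - A. y (\<sigma> ?k))" using c by simp
  also have "\<dots> \<le> sum y (?S - A)" by (rule sum_mono) (use ge in auto)
  finally have "sum y (A - ?S) < sum y (?S - A)" .
  moreover have "sum y A = sum y (A - ?S) + sum y (A \<inter> ?S)"
    using fin by (metis add.commute sum.Int_Diff)
  moreover have "sum y ?S = sum y (?S - A) + sum y (A \<inter> ?S)"
    using fin by (metis add.commute sum.Int_Diff Int_commute)
  ultimately show ?thesis by linarith
qed

lemma strictly_below_step:
  assumes s: "sorts n y \<sigma>" and A: "A \<subseteq> {1..n}" and d: "dominated n \<sigma> t t'"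
    and le: "(\<Sum>a=1..n. y a * t a) \<le> (\<Sum>a=1..n. y a * t' a)" and "c > 0"
    and "strictly_below n y \<sigma> t t' \<or> A \<noteq> \<sigma> ` {1..card A}"
  shows "strictly_below n y \<sigma> (t + (\<lambda>a. c * cube_point A a)) (t' + (\<lambda>a. c * cube_point (\<sigma> ` {1..card A}) a))"
proof -
  have p: "\<sigma> permutes {1..n}" using s by (simp add: sorts_def)
  have S_sub: "\<sigma> ` {1..card A} \<subseteq> {1..n}"
    by (rule permutes_prefix_subset[OF p card_le_bound[OF A]])
  have e: "(\<Sum>a=1..n. y a * (f + (\<lambda>a. c * cube_point B a)) a) = (\<Sum>a=1..n. y a * f a) + c * sum y B"
    if B: "B \<subseteq> {1..n}" for f B
  proof -
    have "(\<Sum>a=1..n. y a * (f + (\<lambda>a. c * cube_point B a)) a) =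
        (\<Sum>a=1..n. y a * f a) + (\<Sum>a=1..n. y a * (c * cube_point B a))"
      by (simp add: distrib_left sum.distrib)
    then show ?thesis unfolding sum_scaled_cube_point[OF subset_refl] using B by (simp add: Int_absorb2)
  qed
  have "sum y A \<le> sum y (\<sigma> ` {1..card A})"
    using sum_top_greatest[OF s A] by (cases "A = \<sigma> ` {1..card A}") auto
  then have m: "c * sum y A \<le> c * sum y (\<sigma> ` {1..card A})" by (rule mult_le_mono2)
  have "(\<Sum>a=1..n. y a * t a) + c * sum y A < (\<Sum>a=1..n. y a * t' a) + c * sum y (\<sigma> ` {1..card A})"
  proof (cases "A = \<sigma> ` {1..card A}")
    case True
    then show ?thesis using assms(6) m by (simp add: strictly_below_def)
  next
    case False
    then have "c * sum y A < c * sum y (\<sigma> ` {1..card A})"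
      using sum_top_greatest[OF s A] \<open>c > 0\<close> by simp
    then show ?thesis using le by linarith
  qed
  then show ?thesis
    unfolding strictly_below_def e[OF A] e[OF S_sub]
    using dominated_step[OF p d A] by simp
qed

text \<open>
  The form is quadratic, and the part that is linear in \<open>s\<close> is twice the pairing with \<open>letter_key n u\<close>.
\<close>

lemma height_less:
  assumes "strictly_below n (letter_key n u) \<sigma> s s'"
  shows "height n (u + s) < height n (u + s')"
proof -
  have e: "height n (u + t) = height n u + 2 * (\<Sum>a=1..n. letter_key n u a * t a) +
      (n + 1) * (\<Sum>a=1..n. (t a)\<^sup>2)" for t
  proof -
    have "m * (x + z)\<^sup>2 + 2 * c * (x + z) = m * x\<^sup>2 + 2 * c * x + 2 * ((m * x + c) * z) + m * z\<^sup>2"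
      for m x z c :: nat
      by (simp add: power2_eq_square algebra_simps)
    then show ?thesis
      unfolding height_def sum_distrib_left sum.distrib[symmetric] letter_key_def plus_fun_apply
      by (intro sum.cong refl)
  qed
  have "(\<Sum>a=1..n. letter_key n u a * s a) < (\<Sum>a=1..n. letter_key n u a * s' a)"
    "(n + 1) * (\<Sum>a=1..n. (s a)\<^sup>2) \<le> (n + 1) * (\<Sum>a=1..n. (s' a)\<^sup>2)"
    using assms by (simp_all add: strictly_below_def dominated_def del: mult_Suc)
  then show ?thesis unfolding e by linarith
qed

subsection \<open>Multiplication by a parameter\<close>

text \<open>
  The generators of \<open>invar r n\<close>, the case \<open>k = 0\<close> included.
\<close>

definition theta :: "nat \<Rightarrow> nat \<Rightarrow> nat \<Rightarrow> zpoly" where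
  "theta r n k = (\<Sum>A | A \<subseteq> {1..n} \<and> card A = k. zvar A ^ rho r k)"

lemma single_power: "Poly_Mapping.single v (1::complex) ^ c = Poly_Mapping.single (\<lambda>a::nat. c * v a :: nat) 1"
proof (induction c)
  case (Suc c)
  then show ?case by (simp add: mult_single plus_fun_def)
qed (simp add: zero_fun_def[symmetric])

lemma cube_map_power: "cube_map (p ^ c) = cube_map p ^ c"
  by (induction c) (simp_all add: cube_map_mult)

lemma cube_map_theta:
  "cube_map (theta r n k) =
    (\<Sum>A | A \<subseteq> {1..n} \<and> card A = k. Poly_Mapping.single (\<lambda>a. rho r k * cube_point A a) 1)"
  by (simp add: theta_def cube_map_sum cube_map_power cube_map_zvar single_power)

definition has_leading :: "nat \<Rightarrow> (nat \<Rightarrow> nat) \<Rightarrow> (nat \<Rightarrow> nat) \<Rightarrow> (nat \<Rightarrow> nat) \<Rightarrow>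
    ((nat \<Rightarrow> nat) \<Rightarrow>\<^sub>0 complex) \<Rightarrow> bool" where
  "has_leading n y \<sigma> s Q \<longleftrightarrow> dominated n \<sigma> s s \<and>
    (\<exists>R. Q = Poly_Mapping.single s 1 + R \<and> (\<forall>t\<in>Poly_Mapping.keys R. strictly_below n y \<sigma> t s))"

lemma keys_mult_single:
  "Poly_Mapping.keys (R * Poly_Mapping.single v c) \<subseteq> (\<lambda>t. t + v) ` Poly_Mapping.keys R"
  using keys_mult[of R "Poly_Mapping.single v c"] by (auto split: if_splits)

lemma keys_sum_subset: "Poly_Mapping.keys (sum f S) \<subseteq> (\<Union>x\<in>S. Poly_Mapping.keys (f x))"
  by (induction S rule: infinite_finite_induct) (use keys_add in fastforce)+

text \<open>
  A term of the product comes from a term of \<open>Q\<close> and a set \<open>A\<close> of size \<open>k\<close>. Unless both are the leading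
  choices, one of the two comparisons is strict.
\<close>

lemma has_leading_step:
  assumes s: "sorts n y \<sigma>" and "has_leading n y \<sigma> t Q" and k: "k \<le> n" and r: "r \<ge> 1"
  shows "has_leading n y \<sigma> (t + (\<lambda>a. rho r k * cube_point (\<sigma> ` {1..k}) a)) (Q * cube_map (theta r n k))"
proof -
  have p: "\<sigma> permutes {1..n}" using s by (simp add: sorts_def)
  let ?S = "\<sigma> ` {1..k}" let ?F = "{A. A \<subseteq> {1..n} \<and> card A = k}"
  let ?v = "\<lambda>A a. rho r k * cube_point A a"
  let ?X = "\<lambda>A. Poly_Mapping.single (?v A) (1::complex)"
  have c: "rho r k > 0" using r by (simp add: rho_def)
  have cS: "card ?S = k" using permutes_inj_on[OF p] by (simp add: card_image)
  have S_sub: "?S \<subseteq> {1..n}" by (rule permutes_prefix_subset[OF p k])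
  have SF: "?S \<in> ?F" using cS S_sub by simp
  have finF: "finite ?F" by (rule finite_subset[of _ "Pow {1..n}"]) auto
  obtain R where R: "Q = Poly_Mapping.single t 1 + R" "\<And>u. u \<in> Poly_Mapping.keys R \<Longrightarrow> strictly_below n y \<sigma> u t"
    and d: "dominated n \<sigma> t t"
    using assms(2) unfolding has_leading_def by blast
  have keyQ: "u = t \<or> strictly_below n y \<sigma> u t" if "u \<in> Poly_Mapping.keys Q" for u
  proof -
    have "u \<in> Poly_Mapping.keys (Poly_Mapping.single t (1::complex)) \<union> Poly_Mapping.keys R"
      using that keys_add[of "Poly_Mapping.single t (1::complex)" R] unfolding R(1)[symmetric] by blast
    then have "u = t \<or> u \<in> Poly_Mapping.keys R" by simp
    then show ?thesis using R(2) by blast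
  qed
  define R' where "R' = R * ?X ?S + (\<Sum>A\<in>?F - {?S}. Q * ?X A)"
  have "Q * cube_map (theta r n k) = Q * ?X ?S + (\<Sum>A\<in>?F - {?S}. Q * ?X A)"
    unfolding cube_map_theta sum.remove[OF finF SF] by (simp add: distrib_left sum_distrib_left)
  also have "\<dots> = Poly_Mapping.single (t + ?v ?S) 1 + R'"
    by (subst (1) R(1)) (simp add: R'_def distrib_right mult_single)
  finally have eq: "Q * cube_map (theta r n k) = Poly_Mapping.single (t + ?v ?S) 1 + R'" .
  have "strictly_below n y \<sigma> u (t + ?v ?S)" if u: "u \<in> Poly_Mapping.keys R'" for u
  proof -
    have "u \<in> Poly_Mapping.keys (R * ?X ?S) \<or>
        u \<in> Poly_Mapping.keys (\<Sum>A\<in>?F - {?S}. Q * ?X A)"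
      using subsetD[OF keys_add u[unfolded R'_def]] by (simp only: Un_iff)
    moreover have "\<exists>A\<in>?F - {?S}. u \<in> Poly_Mapping.keys (Q * ?X A)"
      if "u \<in> Poly_Mapping.keys (\<Sum>A\<in>?F - {?S}. Q * ?X A)"
      using subsetD[OF keys_sum_subset that] by (simp only: UN_iff)
    ultimately have "u \<in> Poly_Mapping.keys (R * ?X ?S) \<or>
        (\<exists>A\<in>?F - {?S}. u \<in> Poly_Mapping.keys (Q * ?X A))"
      by meson
    then show ?thesis
    proof
      assume "u \<in> Poly_Mapping.keys (R * ?X ?S)"
      then obtain w where w: "w \<in> Poly_Mapping.keys R" "u = w + ?v ?S"
        using keys_mult_single by blast
      have "strictly_below n y \<sigma> (w + ?v ?S) (t + (\<lambda>a. rho r k * cube_point (\<sigma> ` {1..card ?S}) a))"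
        using R(2)[OF w(1)] by (intro strictly_below_step[OF s S_sub _ _ c]) (auto simp: strictly_below_def)
      then show ?thesis by (simp only: cS w(2))
    next
      assume "\<exists>A\<in>?F - {?S}. u \<in> Poly_Mapping.keys (Q * ?X A)"
      then obtain A where A: "A \<subseteq> {1..n}" "card A = k" "A \<noteq> ?S" "u \<in> Poly_Mapping.keys (Q * ?X A)"
        by blast
      then obtain w where w: "w \<in> Poly_Mapping.keys Q" "u = w + ?v A"
        using keys_mult_single by blast
      have "strictly_below n y \<sigma> (w + ?v A) (t + (\<lambda>a. rho r k * cube_point (\<sigma> ` {1..card A}) a))"
        using keyQ[OF w(1)] d A(2,3)
        by (intro strictly_below_step[OF s A(1) _ _ c]) (auto simp: strictly_below_def)
      then show ?thesis by (simp only: A(2) w(2))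
    qed
  qed
  moreover have "dominated n \<sigma> (t + ?v ?S) (t + ?v ?S)"
    using dominated_step[OF p d S_sub, of "rho r k"] unfolding cS .
  ultimately show ?thesis unfolding has_leading_def using eq by blast
qed

lemma has_leading_thetas:
  assumes "sorts n y \<sigma>" "set_mset \<alpha> \<subseteq> {0..n}" "r \<ge> 1"
  shows "has_leading n y \<sigma> (\<Sum>k\<in>#\<alpha>. (\<lambda>a. rho r k * cube_point (\<sigma> ` {1..k}) a)) (\<Prod>k\<in>#\<alpha>. cube_map (theta r n k))"
  using assms(2)
proof (induction \<alpha>)
  case empty
  show ?case unfolding has_leading_def by (intro conjI exI[of _ 0]) (auto simp: dominated_def)
next
  case (add k \<alpha>)
  then have "has_leading n y \<sigma> (\<Sum>k\<in>#\<alpha>. (\<lambda>a. rho r k * cube_point (\<sigma> ` {1..k}) a)) (\<Prod>k\<in>#\<alpha>. cube_map (theta r n k))"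
    and "k \<le> n" by auto
  from has_leading_step[OF assms(1) this assms(3)] show ?case
    by (simp only: image_mset_add_mset sum_mset.add_mset prod_mset.add_mset add.commute mult.commute)
qed

section \<open>A basis of the semigroup algebra\<close>

text \<open>
  Scalars act through the constant polynomials.
\<close>

global_interpretation cube: vector_space "\<lambda>(c::complex) (p::(nat \<Rightarrow> nat) \<Rightarrow>\<^sub>0 complex). Poly_Mapping.single 0 c * p"
  by unfold_locales
    (simp_all add: distrib_left distrib_right single_add mult_single mult.assoc[symmetric])

text \<open>
  Elimination from below: each exponent in \<open>W\<close> leads some \<open>E k\<close>, and the rest of \<open>E k\<close> is already
  known to lie in the span.
\<close>

lemma triangular_span:
  fixes E :: "'i \<Rightarrow> (nat \<Rightarrow> nat) \<Rightarrow>\<^sub>0 complex" and h :: "(nat \<Rightarrow> nat) \<Rightarrow> nat"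
  assumes tri: "\<And>k. k \<in> K \<Longrightarrow> \<exists>R. E k = Poly_Mapping.single (l k) 1 + R \<and>
      (\<forall>u\<in>Poly_Mapping.keys R. u \<in> W \<and> h u < h (l k))"
    and surj: "l ` K = W" and "w \<in> W"
  shows "Poly_Mapping.single w 1 \<in> cube.span (E ` K)"
  using \<open>w \<in> W\<close>
proof (induction "h w" arbitrary: w rule: less_induct)
  case less
  obtain k where k: "k \<in> K" "w = l k" using surj less.prems by blast
  obtain R where R: "E k = Poly_Mapping.single w 1 + R"
    "\<And>u. u \<in> Poly_Mapping.keys R \<Longrightarrow> u \<in> W \<and> h u < h w"
    using tri[OF k(1)] k(2) by auto
  have "R = (\<Sum>u\<in>Poly_Mapping.keys R. Poly_Mapping.single 0 (Poly_Mapping.lookup R u) * Poly_Mapping.single u 1)"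
    by (subst (1) sum_of_terms[of R]) (simp add: mult_single)
  also have "\<dots> \<in> cube.span (E ` K)"
    using less.hyps R(2) by (intro cube.span_sum cube.span_scale) auto
  finally have "R \<in> cube.span (E ` K)" .
  then have "E k - R \<in> cube.span (E ` K)"
    using k(1) by (intro cube.span_diff[OF cube.span_base]) auto
  then show ?case by (simp add: R(1))
qed

text \<open>
  In a linear relation, the leading exponent of greatest height among the vectors that occur is not
  cancelled by any other vector.
\<close>

lemma triangular_inj_independent:
  fixes E :: "'i \<Rightarrow> (nat \<Rightarrow> nat) \<Rightarrow>\<^sub>0 complex" and h :: "(nat \<Rightarrow> nat) \<Rightarrow> nat"
  assumes tri: "\<And>k. k \<in> K \<Longrightarrow> \<exists>R. E k = Poly_Mapping.single (l k) 1 + R \<and>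
      (\<forall>u\<in>Poly_Mapping.keys R. u \<in> W \<and> h u < h (l k))"
    and inj: "inj_on l K"
  shows "inj_on E K" "cube.independent (E ` K)"
proof -
  have one: "Poly_Mapping.lookup (E k) (l k) = 1" if k: "k \<in> K" for k
  proof -
    obtain R where R: "E k = Poly_Mapping.single (l k) 1 + R"
      "\<forall>u\<in>Poly_Mapping.keys R. u \<in> W \<and> h u < h (l k)"
      using tri[OF k] by blast
    then have "l k \<notin> Poly_Mapping.keys R" by blast
    then show ?thesis by (simp add: R(1) lookup_add in_keys_iff)
  qed
  have lower: "h (l j) < h (l k)" if "j \<in> K" "k \<in> K" "j \<noteq> k" "Poly_Mapping.lookup (E k) (l j) \<noteq> 0" for j k
  proof -
    obtain R where R: "E k = Poly_Mapping.single (l k) 1 + R"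
      "\<forall>u\<in>Poly_Mapping.keys R. u \<in> W \<and> h u < h (l k)"
      using tri[OF \<open>k \<in> K\<close>] by blast
    have "l j \<noteq> l k" using inj that by (auto dest: inj_onD)
    then have "l j \<in> Poly_Mapping.keys R"
      using that(4) by (simp add: R(1) lookup_add lookup_single_not_eq in_keys_iff)
    then show ?thesis using R(2) by blast
  qed
  show injE: "inj_on E K"
  proof (rule inj_onI, rule ccontr)
    fix j k assume jk: "j \<in> K" "k \<in> K" "E j = E k" "j \<noteq> k"
    have "h (l j) < h (l k)" using lower[of j k] jk one[of j] by simp
    moreover have "h (l k) < h (l j)" using lower[of k j] jk one[of k] by simp
    ultimately show False by simp
  qed
  show "cube.independent (E ` K)"
    unfolding cube.dependent_explicit
  proof (rule notI, elim exE conjE bexE)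
    fix T u v
    assume T: "finite T" "T \<subseteq> E ` K" and v: "v \<in> T" "u v \<noteq> 0"
      and zero: "(\<Sum>v\<in>T. Poly_Mapping.single 0 (u v) * v) = 0"
    define S where "S = {k \<in> K. E k \<in> T \<and> u (E k) \<noteq> 0}"
    have "finite (E -` T \<inter> K)" by (rule finite_vimage_IntI[OF T(1) injE])
    then have finS: "finite S" by (rule rev_finite_subset) (auto simp: S_def)
    have "S \<noteq> {}" using v T(2) by (auto simp: S_def)
    then have "(MAX k\<in>S. h (l k)) \<in> (\<lambda>k. h (l k)) ` S" using finS by (intro Max_in) auto
    then obtain k where k: "k \<in> S" "h (l k) = (MAX k\<in>S. h (l k))" by auto
    then have max: "h (l j) \<le> h (l k)" if "j \<in> S" for j using finS that by simp
    have "0 = Poly_Mapping.lookup (\<Sum>v\<in>T. Poly_Mapping.single 0 (u v) * v) (l k)" by (simp add: zero)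
    also have "\<dots> = (\<Sum>v\<in>T. u v * Poly_Mapping.lookup v (l k))"
      by (auto simp: lookup_sum mult_map_scale_conv_mult[symmetric] Poly_Mapping.map.rep_eq when_def
          intro!: sum.cong)
    also have "\<dots> = (\<Sum>v\<in>T. if v = E k then u v else 0)"
    proof (rule sum.cong[OF refl])
      fix v assume vT: "v \<in> T"
      show "u v * Poly_Mapping.lookup v (l k) = (if v = E k then u v else 0)"
      proof (cases "v = E k")
        case True
        then show ?thesis using one k(1) by (simp add: S_def)
      next
        case False
        obtain j where j: "j \<in> K" "v = E j" using vT T(2) by blast
        have "u v = 0 \<or> Poly_Mapping.lookup v (l k) = 0"
        proof (rule ccontr)
          assume *: "\<not> (u v = 0 \<or> Poly_Mapping.lookup v (l k) = 0)"
          then have "j \<in> S" using j vT by (simp add: S_def)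
          moreover have "h (l k) < h (l j)"
            using lower[of k j] j k(1) False * by (auto simp: S_def)
          ultimately show False using max[of j] by simp
        qed
        then show ?thesis using False by auto
      qed
    qed
    also have "\<dots> = u (E k)" using k(1) T(1) by (simp add: S_def)
    finally show False using k(1) by (simp add: S_def)
  qed
qed

lemma flag_exponent_add:
  "flag_exponent n \<sigma> (\<lambda>k. e k + e' k) = flag_exponent n \<sigma> e + flag_exponent n \<sigma> e'"
  by (simp add: flag_exponent_def fun_eq_iff distrib_right sum.distrib)

lemma sum_mset_flag:
  assumes "set_mset M \<subseteq> {0..n}"
  shows "(\<Sum>k\<in>#M. (\<lambda>a. c k * cube_point (\<sigma> ` {1..k}) a)) = flag_exponent n \<sigma> (\<lambda>k. c k * count M k)"
  using assms
proof (induction M)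
  case (add x M)
  have "flag_exponent n \<sigma> (\<lambda>k. c k * count (add_mset x M) k) =
      flag_exponent n \<sigma> (\<lambda>k. c k * of_bool (k = x)) + flag_exponent n \<sigma> (\<lambda>k. c k * count M k)"
    unfolding flag_exponent_add[symmetric] by (rule flag_exponent_cong) (simp add: algebra_simps)
  also have "flag_exponent n \<sigma> (\<lambda>k. c k * of_bool (k = x)) = (\<lambda>a. c x * cube_point (\<sigma> ` {1..x}) a)"
  proof
    fix a
    have "flag_exponent n \<sigma> (\<lambda>k. c k * of_bool (k = x)) a =
        (\<Sum>k\<le>n. if k = x then c k * cube_point (\<sigma> ` {1..k}) a else 0)"
      unfolding flag_exponent_def by (rule sum.cong) auto
    also have "\<dots> = c x * cube_point (\<sigma> ` {1..x}) a" using add.prems by simp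
    finally show "flag_exponent n \<sigma> (\<lambda>k. c k * of_bool (k = x)) a = c x * cube_point (\<sigma> ` {1..x}) a" .
  qed
  finally show ?case using add by (simp only: image_mset_add_mset sum_mset.add_mset) simp
qed (simp add: flag_exponent_def fun_eq_iff)

lemma finite_Des [simp]: "finite (Des n \<sigma>)"
  by (rule finite_subset[of _ "{1..n-1}"]) (auto simp: Des_def)

lemma b_elem_zmon:
  "b_elem n (\<sigma>, X) = zmon (image_mset (\<lambda>j. \<sigma> ` {1..j}) (mset_set (Des n \<sigma>) + X))"
  by (simp add: b_elem_def prod_unfold_prod_mset image_mset.compositionality comp_def)

lemma b_elem_in_T:
  assumes "i \<in> index_pairs r n" shows "b_elem n i \<in> carrier (T_ring n)"
proof -
  obtain \<sigma> X where i: "i = (\<sigma>, X)" by (metis prod.collapse)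
  have p: "\<sigma> permutes {1..n}" and X: "set_mset X \<subseteq> {1..n}"
    using assms by (auto simp: i index_pairs_def)
  have "set_mset (mset_set (Des n \<sigma>) + X) \<subseteq> {1..n}"
    using X by (auto simp: Des_def)
  then have "\<sigma> ` {1..j} \<subseteq> {1..n}" if "j \<in># mset_set (Des n \<sigma>) + X" for j
    using that by (intro permutes_prefix_subset[OF p]) (meson atLeastAtMost_iff subsetD)
  then show ?thesis
    unfolding i b_elem_zmon image_mset.compositionality comp_def
    by (intro T_prod_mset T_zvar)
qed

lemma cube_map_b_elem:
  assumes "(\<sigma>, X) \<in> index_pairs r n"
  shows "cube_map (b_elem n (\<sigma>, X)) =
    Poly_Mapping.single (flag_exponent n \<sigma> (\<lambda>k. of_bool (k \<in> Des n \<sigma>) + count X k)) 1"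
proof -
  let ?M = "mset_set (Des n \<sigma>) + X"
  have "set_mset ?M \<subseteq> {0..n}"
    using assms unfolding index_pairs_def by (auto simp: Des_def dest: subsetD)
  then have "(\<Sum>k\<in>#?M. (\<lambda>a. 1 * cube_point (\<sigma> ` {1..k}) a)) = flag_exponent n \<sigma> (\<lambda>k. 1 * count ?M k)"
    by (rule sum_mset_flag)
  moreover have "count ?M k = of_bool (k \<in> Des n \<sigma>) + count X k" for k
    by (simp add: count_mset_set')
  ultimately show ?thesis
    unfolding b_elem_zmon cube_map_zmon unfolding image_mset.compositionality comp_def by simp
qed

definition theta_product :: "nat \<Rightarrow> nat \<Rightarrow> nat multiset \<Rightarrow> zpoly" where
  "theta_product r n \<alpha> = (\<Prod>k\<in>#\<alpha>. theta r n k)"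

definition cube_vector :: "nat \<Rightarrow> nat \<Rightarrow> index \<Rightarrow> (nat \<Rightarrow> nat) \<Rightarrow>\<^sub>0 complex" where
  "cube_vector r n = (\<lambda>(i, \<alpha>). cube_map (b_elem n i * theta_product r n \<alpha>))"

lemma theta_in_T: "theta r n k \<in> carrier (T_ring n)"
  unfolding theta_def by (intro T_sum T_power T_zvar) auto

lemma theta_product_in_T: "theta_product r n \<alpha> \<in> carrier (T_ring n)"
  unfolding theta_product_def by (intro T_prod_mset theta_in_T)

lemma keys_cube_map:
  assumes "p \<in> carrier (T_ring n)" "w \<in> Poly_Mapping.keys (cube_map p)"
  shows "w \<in> cube_exponents n"
proof -
  have "w \<in> (\<Union>m\<in>Poly_Mapping.keys p. Poly_Mapping.keys (Poly_Mapping.single (exponent m) (Poly_Mapping.lookup p m)))"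
    using subsetD[OF keys_sum_subset] assms(2) unfolding cube_map_def pushforward_def .
  then obtain m where m: "m \<in> Poly_Mapping.keys p" "w = exponent m" by (auto split: if_splits)
  have sub: "A \<subseteq> {1..n}" if "A \<in> Poly_Mapping.keys m" for A
    using assms(1) m(1) that by (auto simp: in_T_iff)
  have "exponent m a \<le> exponent m 0" for a
    unfolding exponent_def by (intro sum_mono mult_left_mono) (auto simp: cube_point_def)
  moreover have "exponent m a = 0" if "a > n" for a
    unfolding exponent_def using sub that by (fastforce simp: cube_point_def intro!: sum.neutral)
  ultimately show ?thesis by (simp add: cube_exponents_def m(2))
qed

text \<open>
  The exponent \<open>u\<close> of the basis element is sorted by \<open>\<sigma>\<close>, so that \<open>letter_key n u\<close> can serve as the
  weight for comparing the terms of the product of parameters.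
\<close>

lemma cube_vector_triangular:
  assumes r: "r \<ge> 1" and k: "k \<in> full_indices r n"
  shows "\<exists>R. cube_vector r n k = Poly_Mapping.single (lead r n k) 1 + R \<and>
      (\<forall>u\<in>Poly_Mapping.keys R. u \<in> cube_exponents n \<and> height n u < height n (lead r n k))"
proof -
  obtain \<sigma> X \<alpha> where k_eq: "k = ((\<sigma>, X), \<alpha>)" by (metis prod.collapse)
  have i: "(\<sigma>, X) \<in> index_pairs r n" and p: "\<sigma> permutes {1..n}" and a: "set_mset \<alpha> \<subseteq> {0..n}"
    using k by (auto simp: k_eq full_indices_def index_pairs_def)
  define u where "u = flag_exponent n \<sigma> (\<lambda>k. of_bool (k \<in> Des n \<sigma>) + count X k)"
  define s where "s = flag_exponent n \<sigma> (\<lambda>k. rho r k * count \<alpha> k)"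
  have l: "lead r n k = u + s"
    by (simp add: k_eq lead_def u_def s_def flag_exponent_add[symmetric])
  have "sorts n (letter_key n u) \<sigma>"
    unfolding u_def by (rule flag_exponent_sorted[OF p]) simp
  from has_leading_thetas[OF this a r]
  have "has_leading n (letter_key n u) \<sigma> s (cube_map (theta_product r n \<alpha>))"
    unfolding sum_mset_flag[OF a] s_def theta_product_def cube_map_prod_mset .
  then obtain R where R: "cube_map (theta_product r n \<alpha>) = Poly_Mapping.single s 1 + R"
    "\<And>t. t \<in> Poly_Mapping.keys R \<Longrightarrow> strictly_below n (letter_key n u) \<sigma> t s"
    unfolding has_leading_def by blast
  define R' where "R' = R * Poly_Mapping.single u 1"
  have eq: "cube_vector r n k = Poly_Mapping.single (u + s) 1 + R'"
    unfolding k_eq cube_vector_def prod.case cube_map_mult cube_map_b_elem[OF i] u_def[symmetric] R(1) R'_def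
    by (simp add: distrib_left mult_single mult.commute add.commute[of s u])
  have "height n w < height n (u + s)" if w: "w \<in> Poly_Mapping.keys R'" for w
  proof -
    obtain t where t: "t \<in> Poly_Mapping.keys R" "w = t + u"
      using subsetD[OF keys_mult_single w[unfolded R'_def]] by blast
    then show ?thesis using height_less[OF R(2)[OF t(1)]] by (simp add: add.commute)
  qed
  moreover have "w \<in> cube_exponents n" if w: "w \<in> Poly_Mapping.keys R'" for w
  proof -
    have "w \<noteq> u + s" using calculation[OF w] by blast
    then have "w \<in> Poly_Mapping.keys (cube_vector r n k)"
      using w by (simp add: eq in_keys_iff lookup_add lookup_single_not_eq)
    then show ?thesis
      unfolding k_eq cube_vector_def prod.case
      by (rule keys_cube_map[OF T_mult[OF b_elem_in_T[OF i] theta_product_in_T]])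
  qed
  ultimately show ?thesis unfolding l using eq by blast
qed

lemma cube_vector_basis:
  assumes "r \<ge> 1" "n \<ge> 1"
  shows "inj_on (cube_vector r n) (full_indices r n)"
    and "cube.independent (cube_vector r n ` full_indices r n)"
    and "p \<in> carrier (T_ring n) \<Longrightarrow> cube_map p \<in> cube.span (cube_vector r n ` full_indices r n)"
proof -
  note tri = cube_vector_triangular[OF assms(1)] and bij = lead_bij[OF assms]
  show "inj_on (cube_vector r n) (full_indices r n)"
    "cube.independent (cube_vector r n ` full_indices r n)"
    by (rule triangular_inj_independent[OF tri bij_betw_imp_inj_on[OF bij]]; assumption)+
  assume p: "p \<in> carrier (T_ring n)"
  have "cube_map p = (\<Sum>w\<in>Poly_Mapping.keys (cube_map p).
      Poly_Mapping.single 0 (Poly_Mapping.lookup (cube_map p) w) * Poly_Mapping.single w 1)"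
    by (subst (1) sum_of_terms[of "cube_map p"]) (simp add: mult_single)
  also have "\<dots> \<in> cube.span (cube_vector r n ` full_indices r n)"
    by (intro cube.span_sum cube.span_scale triangular_span[OF tri bij_betw_imp_surj_on[OF bij]]
        keys_cube_map[OF p])
  finally show "cube_map p \<in> cube.span (cube_vector r n ` full_indices r n)" .
qed

section \<open>The basis modulo the parameters\<close>

lemma invar_eq: "invar r n = Idl\<^bsub>T_ring n\<^esub> (theta r n ` {0..n})"
proof -
  have 0: "theta r n 0 = zvar {}"
  proof -
    have "{A. A \<subseteq> {1..n} \<and> card A = 0} = {{}}"
      using finite_subset by fastforce
    then show ?thesis by (simp add: theta_def rho_def)
  qed
  have "theta r n ` {1..n} = {\<Sum>A | A \<subseteq> {1..n} \<and> card A = k. zvar A ^ r | k. 1 \<le> k \<and> k \<le> n}"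
    by (force simp: theta_def rho_def)
  moreover have "{0..n} = insert 0 {1..n}" by auto
  ultimately show ?thesis by (simp add: invar_def 0)
qed

lemma invar_ideal: "ideal (invar r n) (T_ring n)"
  unfolding invar_eq
  by (rule ring.genideal_ideal[OF T_is_ring]) (auto intro: theta_in_T)

lemma theta_in_invar: "k \<le> n \<Longrightarrow> theta r n k \<in> invar r n"
  unfolding invar_eq
  by (intro subsetD[OF ring.genideal_self[OF T_is_ring]]) (auto intro: theta_in_T)

lemma J_ideal_alt: "J_ideal r n = {a + b | a b. a \<in> invar r n \<and> b \<in> I_ideal n}"
  by (auto simp: J_ideal_def set_add_def')

lemma J_ideal_ideal: "ideal (J_ideal r n) (T_ring n)"
  unfolding J_ideal_def
  by (rule ring.add_ideals[OF T_is_ring invar_ideal I_ideal_ideal])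

lemma invar_subset_J: "invar r n \<subseteq> J_ideal r n"
  unfolding J_ideal_alt using T_ideal_zero[OF I_ideal_ideal[of n]] by force

lemma I_subset_J: "I_ideal n \<subseteq> J_ideal r n"
  unfolding J_ideal_alt using T_ideal_zero[OF invar_ideal[of r n]] by force

subsection \<open>Independence modulo \<open>J\<close>\<close>

text \<open>
  The basis vectors with at least one parameter as a factor span a set that contains the image of \<open>J\<close>.
\<close>

definition higher_span :: "nat \<Rightarrow> nat \<Rightarrow> ((nat \<Rightarrow> nat) \<Rightarrow>\<^sub>0 complex) set" where
  "higher_span r n = cube.span (cube_vector r n ` {k \<in> full_indices r n. snd k \<noteq> {#}})"

text \<open>
  Multiplication by parameters maps basis vectors to basis vectors, as it only adds to \<open>\<alpha>\<close>.
\<close>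

lemma theta_product_times_span:
  assumes "set_mset \<alpha> \<subseteq> {0..n}" "\<alpha> \<noteq> {#}"
    and "f \<in> cube.span (cube_vector r n ` full_indices r n)"
  shows "cube_map (theta_product r n \<alpha>) * f \<in> higher_span r n"
  using assms(3)
proof (induction rule: cube.span_induct_alt)
  case base
  then show ?case by (simp add: higher_span_def cube.span_zero)
next
  case (step c x y)
  then obtain i \<beta> where k: "x = cube_vector r n (i, \<beta>)" "(i, \<beta>) \<in> full_indices r n" by auto
  have "cube_map (theta_product r n \<alpha>) * x = cube_vector r n (i, \<alpha> + \<beta>)"
    by (simp add: k(1) cube_vector_def theta_product_def cube_map_mult)
  moreover have "(i, \<alpha> + \<beta>) \<in> {k \<in> full_indices r n. snd k \<noteq> {#}}"
    using k(2) assms(1,2) by (auto simp: full_indices_def)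
  ultimately have "cube_map (theta_product r n \<alpha>) * x \<in> higher_span r n"
    unfolding higher_span_def by (auto intro: cube.span_base)
  then have "Poly_Mapping.single 0 c * (cube_map (theta_product r n \<alpha>) * x) + cube_map (theta_product r n \<alpha>) * y \<in> higher_span r n"
    using step(2) unfolding higher_span_def by (intro cube.span_add cube.span_scale)
  then show ?case by (simp add: algebra_simps)
qed

text \<open>
  For \<open>b \<cdot> \<theta>\<^sup>\<alpha>\<close> with \<open>\<alpha> \<noteq> {#}\<close>, the product \<open>t \<cdot> b\<close> can be expanded in the full basis before
  \<open>\<theta>\<^sup>\<alpha>\<close> is multiplied in.
\<close>

lemma higher_span_ideal:
  assumes "r \<ge> 1" "n \<ge> 1" "t \<in> carrier (T_ring n)" "f \<in> higher_span r n"
  shows "cube_map t * f \<in> higher_span r n"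
  using assms(4) unfolding higher_span_def
proof (induction rule: cube.span_induct_alt)
  case base
  then show ?case by (simp only: mult_zero_right cube.span_zero)
next
  case (step c x y)
  then obtain i \<alpha> where k: "x = cube_vector r n (i, \<alpha>)" "(i, \<alpha>) \<in> full_indices r n" "\<alpha> \<noteq> {#}" by auto
  have i: "i \<in> index_pairs r n" "set_mset \<alpha> \<subseteq> {0..n}" using k(2) by (auto simp: full_indices_def)
  have "cube_map (t * b_elem n i) \<in> cube.span (cube_vector r n ` full_indices r n)"
    by (intro cube_vector_basis(3)[OF assms(1,2)] T_mult assms(3) b_elem_in_T[OF i(1)])
  from theta_product_times_span[OF i(2) k(3) this]
  have "cube_map t * x \<in> higher_span r n"
    by (simp add: k(1) cube_vector_def cube_map_mult algebra_simps)
  then have "Poly_Mapping.single 0 c * (cube_map t * x) + cube_map t * y \<in> higher_span r n"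
    using step(2) unfolding higher_span_def by (intro cube.span_add cube.span_scale)
  moreover have "cube_map t * (Poly_Mapping.single 0 c * x + y) = Poly_Mapping.single 0 c * (cube_map t * x) + cube_map t * y"
    by (simp add: algebra_simps)
  ultimately show ?case unfolding higher_span_def by (simp only:)
qed

lemma id_index: "(id, {#}) \<in> index_pairs r n"
  by (simp add: index_pairs_def permutes_id)

lemma b_elem_id: "b_elem n (id, {#}) = 1"
proof -
  have "Des n id = {}" by (auto simp: Des_def)
  then show ?thesis by (simp add: b_elem_def)
qed

text \<open>
  The polynomials with image in \<open>higher_span r n\<close> form an ideal; it contains each \<open>\<theta>\<^sub>k\<close>, as 1 is the
  basis element of \<open>(id, {#})\<close>, and the kernel.
\<close>

lemma cube_map_J_ideal:
  assumes "r \<ge> 1" "n \<ge> 1" "p \<in> J_ideal r n"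
  shows "cube_map p \<in> higher_span r n"
proof -
  have "invar r n \<subseteq> {p \<in> carrier (T_ring n). cube_map p \<in> higher_span r n}"
    unfolding invar_eq
  proof (rule ring.genideal_minimal[OF T_is_ring])
    show "ideal {p \<in> carrier (T_ring n). cube_map p \<in> higher_span r n} (T_ring n)"
    proof (rule T_idealI)
      show "0 \<in> {p \<in> carrier (T_ring n). cube_map p \<in> higher_span r n}"
        by (simp add: T_zero higher_span_def cube.span_zero)
    next
      fix a b assume "a \<in> {p \<in> carrier (T_ring n). cube_map p \<in> higher_span r n}"
        "b \<in> {p \<in> carrier (T_ring n). cube_map p \<in> higher_span r n}"
      then show "a + b \<in> {p \<in> carrier (T_ring n). cube_map p \<in> higher_span r n}"
        by (simp add: T_add cube_map_add higher_span_def cube.span_add)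
    next
      fix a t assume "a \<in> {p \<in> carrier (T_ring n). cube_map p \<in> higher_span r n}" "t \<in> carrier (T_ring n)"
      then show "t * a \<in> {p \<in> carrier (T_ring n). cube_map p \<in> higher_span r n}"
        by (simp add: T_mult cube_map_mult higher_span_ideal[OF assms(1,2)])
    qed auto
    show "theta r n ` {0..n} \<subseteq> {p \<in> carrier (T_ring n). cube_map p \<in> higher_span r n}"
    proof
      fix p assume "p \<in> theta r n ` {0..n}"
      then obtain k where k: "k \<le> n" "p = theta r n k" by auto
      have e: "cube_map p = cube_vector r n ((id, {#}), {#k#})"
        by (simp add: cube_vector_def b_elem_id theta_product_def k(2))
      have "((id, {#}), {#k#}) \<in> {k \<in> full_indices r n. snd k \<noteq> {#}}"
        using k(1) id_index by (simp add: full_indices_def)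
      then have "cube_map p \<in> higher_span r n"
        unfolding higher_span_def e by (intro cube.span_base imageI)
      then show "p \<in> {p \<in> carrier (T_ring n). cube_map p \<in> higher_span r n}"
        by (simp add: k(2) theta_in_T)
    qed
  qed
  then have inv: "cube_map a \<in> higher_span r n" if "a \<in> invar r n" for a using that by blast
  obtain a b where ab: "p = a + b" "a \<in> invar r n" "b \<in> I_ideal n"
    using assms(3) unfolding J_ideal_alt by blast
  then show ?thesis using cube_map_I_ideal[OF ab(3)] inv[OF ab(2)] by (simp add: cube_map_add)
qed

lemma finite_index_pairs: "finite (index_pairs r n)"
proof -
  let ?M = "{X. set_mset X \<subseteq> {1..n} \<and> (\<forall>j. count X j \<le> r - 1)}"
  have "count ` ?M \<subseteq> {f. \<forall>j. (j \<in> {1..n} \<longrightarrow> f j \<in> {..r - 1}) \<and> (j \<notin> {1..n} \<longrightarrow> f j = 0)}"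
    by (auto simp: count_eq_zero_iff)
  moreover have "finite {f::nat \<Rightarrow> nat. \<forall>j. (j \<in> {1..n} \<longrightarrow> f j \<in> {..r - 1}) \<and> (j \<notin> {1..n} \<longrightarrow> f j = 0)}"
    by (rule finite_set_of_finite_funs) auto
  ultimately have "finite (count ` ?M)" by (rule finite_subset)
  then have "finite ?M" by (rule finite_imageD) (simp add: inj_on_def count_inject)
  moreover have "finite {\<sigma>. \<sigma> permutes {1..n}}" by (simp add: finite_permutations)
  moreover have "index_pairs r n = {\<sigma>. \<sigma> permutes {1..n}} \<times> ?M"
    by (auto simp: index_pairs_def)
  ultimately show ?thesis by simp
qed

text \<open>
  A combination of the \<open>b\<close> lies in the span of the basis vectors with \<open>\<alpha> = {#}\<close>, an element of the
  ideal in the span of the others; these spans meet only in 0.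
\<close>

theorem b_elem_independent_mod_J:
  assumes "r \<ge> 1" "n \<ge> 1"
    and "(\<Sum>i\<in>index_pairs r n. zconst (c i) * b_elem n i) \<in> J_ideal r n" and j: "j \<in> index_pairs r n"
  shows "c j = 0"
proof -
  let ?B = "cube_vector r n ` full_indices r n"
  let ?v = "\<lambda>i. cube_vector r n (i, {#})"
  note basis = cube_vector_basis[OF assms(1,2)]
  have full: "(i, {#}) \<in> full_indices r n" if "i \<in> index_pairs r n" for i
    using that by (simp add: full_indices_def)
  have inB: "?v i \<in> ?B" if "i \<in> index_pairs r n" for i using full[OF that] by blast
  let ?x = "\<Sum>i\<in>index_pairs r n. Poly_Mapping.single 0 (c i) * ?v i"
  have "cube_map (\<Sum>i\<in>index_pairs r n. zconst (c i) * b_elem n i) = ?x"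
    by (simp add: cube_map_sum cube_map_mult cube_vector_def theta_product_def)
  then have x: "?x \<in> higher_span r n" using cube_map_J_ideal[OF assms(1-3)] by simp
  have "cube.representation ?B ?x (?v j) = 0"
  proof (rule ccontr)
    let ?H = "cube_vector r n ` {k \<in> full_indices r n. snd k \<noteq> {#}}"
    assume "cube.representation ?B ?x (?v j) \<noteq> 0"
    moreover have "cube.representation ?B ?x = cube.representation ?H ?x"
      by (rule cube.representation_extend[OF basis(2)]) (use x in \<open>auto simp: higher_span_def\<close>)
    ultimately have "cube.representation ?H ?x (?v j) \<noteq> 0" by simp
    then have "?v j \<in> ?H" by (rule cube.representation_ne_zero)
    then obtain k where k: "k \<in> full_indices r n" "snd k \<noteq> {#}" "?v j = cube_vector r n k" by blast
    then have "k = (j, {#})" using inj_onD[OF basis(1) k(3)[symmetric] k(1) full[OF j]] by simp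
    with k(2) show False by simp
  qed
  moreover have "cube.representation ?B ?x (?v j) = (\<Sum>i\<in>index_pairs r n. c i * (if ?v i = ?v j then 1 else 0))"
  proof -
    have s: "Poly_Mapping.single 0 (c i) * ?v i \<in> cube.span ?B" if "i \<in> index_pairs r n" for i
      using inB[OF that] by (intro cube.span_scale cube.span_base)
    have "cube.representation ?B ?x (?v j) =
        (\<Sum>i\<in>index_pairs r n. cube.representation ?B (Poly_Mapping.single 0 (c i) * ?v i) (?v j))"
      using cube.representation_sum[OF basis(2), of "index_pairs r n"] s by simp
    also have "\<dots> = (\<Sum>i\<in>index_pairs r n. c i * (if ?v i = ?v j then 1 else 0))"
    proof (rule sum.cong[OF refl])
      fix i assume i: "i \<in> index_pairs r n"
      show "cube.representation ?B (Poly_Mapping.single 0 (c i) * ?v i) (?v j) = c i * (if ?v i = ?v j then 1 else 0)"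
        using cube.representation_scale[OF basis(2) cube.span_base[OF inB[OF i]], of "c i"]
          cube.representation_basis[OF basis(2) inB[OF i]] by auto
    qed
    finally show ?thesis .
  qed
  moreover have "\<dots> = (\<Sum>i\<in>index_pairs r n. if i = j then c i else 0)"
  proof (rule sum.cong[OF refl])
    fix i assume i: "i \<in> index_pairs r n"
    have "?v i = ?v j \<longleftrightarrow> i = j" using inj_onD[OF basis(1) _ full[OF i] full[OF j]] by auto
    then show "c i * (if ?v i = ?v j then 1 else 0) = (if i = j then c i else 0)" by simp
  qed
  moreover have "\<dots> = c j" using j finite_index_pairs[of r n] by simp
  ultimately show ?thesis by simp
qed

subsection \<open>Spanning modulo \<open>J\<close>\<close>

text \<open>
  The image of \<open>p\<close> is a combination of products \<open>b \<cdot> \<theta>\<^sup>\<alpha>\<close>, and so \<open>p\<close> is this combination up to an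
  element of the kernel, which lies in \<open>J\<close>. The products with \<open>\<alpha> \<noteq> {#}\<close> lie in \<open>J\<close> as well.
\<close>

theorem b_elem_spans_mod_J:
  assumes "r \<ge> 1" "n \<ge> 1" "p \<in> carrier (T_ring n)"
  obtains c where "p - (\<Sum>i\<in>index_pairs r n. zconst (c i) * b_elem n i) \<in> J_ideal r n"
proof -
  note J = J_ideal_ideal[of r n]
  define G where "G = {q \<in> carrier (T_ring n). \<exists>c. q - (\<Sum>i\<in>index_pairs r n. zconst (c i) * b_elem n i) \<in> J_ideal r n}"
  have zc: "zconst (a + b) = zconst a + zconst b" "zconst (a * b) = zconst a * zconst b" for a b
    by (simp_all add: zconst_def single_add mult_single)
  have G_add: "p + q \<in> G" if "p \<in> G" "q \<in> G" for p q
  proof -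
    obtain c d where c: "p - (\<Sum>i\<in>index_pairs r n. zconst (c i) * b_elem n i) \<in> J_ideal r n"
      and d: "q - (\<Sum>i\<in>index_pairs r n. zconst (d i) * b_elem n i) \<in> J_ideal r n"
      using \<open>p \<in> G\<close> \<open>q \<in> G\<close> unfolding G_def by blast
    have "p + q - (\<Sum>i\<in>index_pairs r n. zconst (c i + d i) * b_elem n i) \<in> J_ideal r n"
      using T_ideal_add[OF J c d] by (simp add: zc distrib_right sum.distrib algebra_simps)
    moreover have "p + q \<in> carrier (T_ring n)" using that by (auto simp: G_def intro: T_add)
    ultimately show ?thesis unfolding G_def by (intro CollectI conjI exI[of _ "\<lambda>i. c i + d i"])
  qed
  have G_scale: "zconst a * p \<in> G" if "p \<in> G" for p a
  proof -
    obtain c where c: "p - (\<Sum>i\<in>index_pairs r n. zconst (c i) * b_elem n i) \<in> J_ideal r n"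
      using \<open>p \<in> G\<close> unfolding G_def by blast
    have "zconst a * p - (\<Sum>i\<in>index_pairs r n. zconst (a * c i) * b_elem n i) \<in> J_ideal r n"
      using T_ideal_mult[OF J c T_const[of a]] by (simp add: zc right_diff_distrib sum_distrib_left mult.assoc)
    moreover have "zconst a * p \<in> carrier (T_ring n)" using that by (auto simp: G_def intro: T_mult T_const)
    ultimately show ?thesis unfolding G_def by (intro CollectI conjI exI[of _ "\<lambda>i. a * c i"])
  qed
  have z0: "zconst 0 = 0" "zconst 1 = 1" by (simp_all add: zconst_def)
  have J_G: "p \<in> G" if "p \<in> J_ideal r n" for p
    unfolding G_def using that T_ideal_subset[OF J that]
    by (intro CollectI conjI exI[of _ "\<lambda>_. 0"]) (simp_all add: z0)
  have gen: "b_elem n i * theta_product r n \<alpha> \<in> G" if k: "(i, \<alpha>) \<in> full_indices r n" for i \<alpha>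
  proof -
    have i: "i \<in> index_pairs r n" and a: "set_mset \<alpha> \<subseteq> {0..n}" using k by (auto simp: full_indices_def)
    show ?thesis
    proof (cases \<alpha>)
      case empty
      have "(\<Sum>j\<in>index_pairs r n. zconst (if j = i then 1 else 0) * b_elem n j) =
          (\<Sum>j\<in>index_pairs r n. if j = i then b_elem n j else 0)"
        by (rule sum.cong) (auto simp: z0)
      also have "\<dots> = b_elem n i" using i finite_index_pairs[of r n] by simp
      finally show ?thesis
        unfolding G_def empty using b_elem_in_T[OF i] T_ideal_zero[OF J]
        by (intro CollectI conjI exI[of _ "\<lambda>j. if j = i then 1 else 0"]) (simp_all add: theta_product_def)
    next
      case (add k \<beta>)
      have "theta r n k \<in> J_ideal r n" using a add theta_in_invar[of k n r] invar_subset_J by auto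
      then have "(b_elem n i * theta_product r n \<beta>) * theta r n k \<in> J_ideal r n"
        by (intro T_ideal_mult[OF J] T_mult b_elem_in_T[OF i] theta_product_in_T)
      then show ?thesis by (intro J_G) (simp add: add theta_product_def algebra_simps)
    qed
  qed
  have "\<exists>q\<in>G. cube_map q = f" if "f \<in> cube.span (cube_vector r n ` full_indices r n)" for f
    using that
  proof (induction rule: cube.span_induct_alt)
    case base
    show ?case using J_G[OF T_ideal_zero[OF J]] by (intro bexI[of _ 0]) simp_all
  next
    case (step c x y)
    then obtain q where q: "q \<in> G" "cube_map q = y" by auto
    obtain i \<alpha> where k: "(i, \<alpha>) \<in> full_indices r n" "x = cube_vector r n (i, \<alpha>)" using step by auto
    show ?case
      using G_add[OF G_scale[OF gen[OF k(1)]] q(1), of c]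
      by (intro bexI[of _ "zconst c * (b_elem n i * theta_product r n \<alpha>) + q"])
        (simp_all add: cube_map_add cube_map_mult q(2) k(2) cube_vector_def)
  qed
  from this[OF cube_vector_basis(3)[OF assms]]
  obtain q where q: "q \<in> G" "cube_map q = cube_map p" by blast
  then have qT: "q \<in> carrier (T_ring n)" by (simp add: G_def)
  have "p - q \<in> I_ideal n"
    by (rule cube_map_kernel[OF T_diff[OF assms(3) qT]]) (simp add: cube_map_diff q(2))
  then have "p - q \<in> G" using I_subset_J[of n r] by (intro J_G) blast
  then have "p - q + q \<in> G" using q(1) by (rule G_add)
  then show thesis using that by (auto simp: G_def)
qed

section \<open>The quotient algebra\<close>

lemma invar_bar_ideal: "ideal (invar_bar r n) (R_ring n)"
  unfolding invar_bar_def R_ring_def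
  by (rule ring.ring_ideal_imp_quot_ideal[OF T_is_ring I_ideal_ideal invar_ideal])

lemma Q_ring_is_ring: "ring (Q_ring r n)"
  unfolding Q_ring_def by (rule ideal.quotient_is_ring[OF invar_bar_ideal])

lemma Q_coset_hom: "ring_hom_ring (T_ring n) (Q_ring r n) (Q_coset r n)"
proof (rule ring_hom_ringI2[OF T_is_ring Q_ring_is_ring])
  have "(+>\<^bsub>R_ring n\<^esub>) (invar_bar r n) \<circ> (+>\<^bsub>T_ring n\<^esub>) (I_ideal n) \<in> ring_hom (T_ring n) (Q_ring r n)"
    unfolding Q_ring_def
    by (rule ring_hom_trans[OF ideal.rcos_ring_hom[OF I_ideal_ideal, folded R_ring_def]
          ideal.rcos_ring_hom[OF invar_bar_ideal]])
  moreover have "(+>\<^bsub>R_ring n\<^esub>) (invar_bar r n) \<circ> (+>\<^bsub>T_ring n\<^esub>) (I_ideal n) = Q_coset r n"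
    by (simp add: Q_coset_def fun_eq_iff)
  ultimately show "Q_coset r n \<in> ring_hom (T_ring n) (Q_ring r n)" by simp
qed

lemma Q_coset_surj: "Q_coset r n ` carrier (T_ring n) = carrier (Q_ring r n)"
proof -
  have q: "carrier (S Quot K) = (\<lambda>x. K +>\<^bsub>S\<^esub> x) ` carrier S" for S :: "('z, 'y) ring_scheme" and K
    by (auto simp: FactRing_def A_RCOSETS_def')
  have "carrier (Q_ring r n) = (\<lambda>p. Q_coset r n p) ` carrier (T_ring n)"
    unfolding Q_ring_def q by (simp add: R_ring_def q image_image Q_coset_def)
  then show ?thesis by simp
qed

lemma T_coset_eq_iff:
  assumes "ideal K (T_ring n)" "p \<in> carrier (T_ring n)" "q \<in> carrier (T_ring n)"
  shows "K +>\<^bsub>T_ring n\<^esub> p = K +>\<^bsub>T_ring n\<^esub> q \<longleftrightarrow> p - q \<in> K"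
proof -
  note K = assms(1)
  have c: "K +>\<^bsub>T_ring n\<^esub> x = {a + x | a. a \<in> K}" for x
    by (auto simp: a_r_coset_def')
  show ?thesis unfolding c
  proof
    assume "{a + p |a. a \<in> K} = {a + q |a. a \<in> K}"
    moreover have "p \<in> {a + p |a. a \<in> K}" using T_ideal_zero[OF K] by force
    ultimately obtain a where "a \<in> K" "p = a + q" by blast
    then show "p - q \<in> K" by simp
  next
    assume pq: "p - q \<in> K"
    have "a + p = (a + (p - q)) + q" "a + q = (a - (p - q)) + p" for a by simp_all
    then show "{a + p |a. a \<in> K} = {a + q |a. a \<in> K}"
      using T_ideal_add[OF K _ pq] T_ideal_diff[OF K _ pq] by (safe; metis)
  qed
qed

lemma Q_coset_zero_iff:
  assumes "p \<in> carrier (T_ring n)"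
  shows "Q_coset r n p = \<zero>\<^bsub>Q_ring r n\<^esub> \<longleftrightarrow> p \<in> J_ideal r n"
proof -
  note I = I_ideal_ideal[of n]
  interpret B: ideal "invar_bar r n" "R_ring n" by (rule invar_bar_ideal)
  have pc: "I_ideal n +>\<^bsub>T_ring n\<^esub> p \<in> carrier (R_ring n)"
    using ring_hom_closed[OF ideal.rcos_ring_hom[OF I] assms] by (simp add: R_ring_def)
  have "Q_coset r n p = \<zero>\<^bsub>Q_ring r n\<^esub> \<longleftrightarrow> invar_bar r n +>\<^bsub>R_ring n\<^esub> (I_ideal n +>\<^bsub>T_ring n\<^esub> p) = invar_bar r n"
    by (simp add: Q_coset_def Q_ring_def FactRing_def)
  also have "\<dots> \<longleftrightarrow> I_ideal n +>\<^bsub>T_ring n\<^esub> p \<in> invar_bar r n"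
    using B.a_rcos_const B.a_rcos_self[OF pc] by metis
  also have "\<dots> \<longleftrightarrow> (\<exists>q\<in>invar r n. I_ideal n +>\<^bsub>T_ring n\<^esub> p = I_ideal n +>\<^bsub>T_ring n\<^esub> q)"
    by (auto simp: invar_bar_def)
  also have "\<dots> \<longleftrightarrow> (\<exists>q\<in>invar r n. p - q \<in> I_ideal n)"
    using T_coset_eq_iff[OF I assms] T_ideal_subset[OF invar_ideal] by blast
  also have "\<dots> \<longleftrightarrow> p \<in> J_ideal r n"
  proof
    assume "\<exists>q\<in>invar r n. p - q \<in> I_ideal n"
    then obtain q where "q \<in> invar r n" "p - q \<in> I_ideal n" "p = q + (p - q)" by auto
    then show "p \<in> J_ideal r n" unfolding J_ideal_alt by blast
  next
    assume "p \<in> J_ideal r n"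
    then obtain a b where "p = a + b" "a \<in> invar r n" "b \<in> I_ideal n"
      unfolding J_ideal_alt by blast
    then show "\<exists>q\<in>invar r n. p - q \<in> I_ideal n" by (intro bexI[of _ a]) simp_all
  qed
  finally show ?thesis .
qed

lemma Q_kernel: "a_kernel (T_ring n) (Q_ring r n) (Q_coset r n) = J_ideal r n"
proof -
  have "x \<in> carrier (T_ring n)" if "x \<in> J_ideal r n" for x
    by (rule T_ideal_subset[OF J_ideal_ideal that])
  then show ?thesis unfolding a_kernel_def' using Q_coset_zero_iff by blast
qed

text \<open>
  The map \<open>p \<mapsto> Q_coset r n p\<close> is a surjective homomorphism with kernel \<open>J\<close>; the required map is the
  inverse of the isomorphism that it induces.
\<close>

theorem iterated_quotient_iso:
  "\<exists>h \<in> ring_iso (Q_ring r n) (T_ring n Quot J_ideal r n).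
     \<forall>p \<in> carrier (T_ring n). h (Q_coset r n p) = J_ideal r n +>\<^bsub>T_ring n\<^esub> p"
proof -
  interpret ring_hom_ring "T_ring n" "Q_ring r n" "Q_coset r n" by (rule Q_coset_hom)
  let ?Q = "T_ring n Quot J_ideal r n"
  let ?g = "\<lambda>X. the_elem (Q_coset r n ` X)"
  have g: "?g \<in> ring_iso ?Q (Q_ring r n)"
    using FactRing_iso_set[OF Q_coset_surj] unfolding Q_kernel .
  have rQ: "ring ?Q" by (rule ideal.quotient_is_ring[OF J_ideal_ideal])
  have gp: "?g (J_ideal r n +>\<^bsub>T_ring n\<^esub> p) = Q_coset r n p" if "p \<in> carrier (T_ring n)" for p
    using the_elem_simp[OF that] unfolding Q_kernel .
  have "inv_into (carrier ?Q) ?g (Q_coset r n p) = J_ideal r n +>\<^bsub>T_ring n\<^esub> p"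
    if p: "p \<in> carrier (T_ring n)" for p
    unfolding gp[OF p, symmetric]
    by (rule inv_into_f_f)
      (use g ring_hom_closed[OF ideal.rcos_ring_hom[OF J_ideal_ideal] p] in
        \<open>simp_all add: ring_iso_def bij_betw_def\<close>)
  then show ?thesis using ring_iso_set_sym[OF rQ g] by blast
qed

lemma constants_subfield: "subfield (range zconst) (T_ring n)"
proof -
  have zc: "zconst 0 = 0" "zconst 1 = 1" "zconst a + zconst b = zconst (a + b)"
    "zconst a * zconst b = zconst (a * b)" "- zconst a = zconst (- a)" for a b
    by (simp_all add: zconst_def single_add mult_single single_uminus)
  have inj: "zconst a = 0 \<longleftrightarrow> a = 0" for a
    by (metis zconst_def lookup_single_eq lookup_zero single_zero)
  interpret cring "T_ring n" by (rule T_cring)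
  have neg: "\<ominus>\<^bsub>T_ring n\<^esub> zconst a = zconst (- a)" for a
    by (rule minus_equality) (simp_all add: zc T_const)
  show ?thesis
  proof (rule subfieldI)
    have "subring (range zconst) (T_ring n)"
    proof (rule subringI)
      show "range zconst \<subseteq> carrier (T_ring n)" using T_const by auto
      show "\<one>\<^bsub>T_ring n\<^esub> \<in> range zconst" using zc(2) by (metis T_ring_simps(2) rangeI)
    qed (auto simp: neg zc)
    then show "subcring (range zconst) (T_ring n)"
      by (rule subcringI) (simp add: mult.commute)
    have "\<exists>b. zconst (b * a) = 1" if "a \<noteq> 0" for a
      using that zc(2) by (intro exI[of _ "inverse a"]) simp
    then show "Units (T_ring n \<lparr>carrier := range zconst\<rparr>) = range zconst - {\<zero>\<^bsub>T_ring n\<^esub>}"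
      by (auto simp: Units_def zc inj mult.commute)
  qed
qed

lemma list_as_map:
  assumes "distinct xs" "length cs = length xs"
  obtains c where "cs = map c xs"
proof
  show "cs = map (\<lambda>x. the (map_of (zip xs cs) x)) xs"
    by (rule nth_equalityI) (use assms in \<open>simp_all add: map_of_zip_nth\<close>)
qed

lemma combine_map_sum:
  assumes "distinct xs" "\<And>x. x \<in> set xs \<Longrightarrow> f x \<in> carrier (T_ring n)"
  shows "ring.combine (T_ring n) (map (\<lambda>x. zconst (c x)) xs) (map f xs) = (\<Sum>x\<in>set xs. zconst (c x) * f x)"
  using assms by (induction xs) (simp_all add: ring.combine.simps[OF T_is_ring])

text \<open>
  The family is a basis in the sense of combinations of lists over the subfield of scalars; such
  combinations are lifted along \<open>Q_coset r n\<close> to sums in the polynomial ring.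
\<close>

theorem b_elem_basis:
  assumes "r \<ge> 1" "n \<ge> 1"
  shows "is_basis_family (Q_ring r n) (Q_scalars r n) (index_pairs r n) (\<lambda>i. Q_coset r n (b_elem n i))"
  unfolding is_basis_family_def
proof (intro conjI allI impI finite_index_pairs)
  interpret h: ring_hom_ring "T_ring n" "Q_ring r n" "Q_coset r n" by (rule Q_coset_hom)
  fix xs assume "distinct xs \<and> set xs = index_pairs r n"
  then have xs: "distinct xs" "set xs = index_pairs r n" by auto
  have bT: "b_elem n i \<in> carrier (T_ring n)" if "i \<in> set xs" for i
    using that xs(2) b_elem_in_T by blast
  have usT: "set (map (b_elem n) xs) \<subseteq> carrier (T_ring n)" using bT by auto
  have eq: "map (\<lambda>i. Q_coset r n (b_elem n i)) xs = map (Q_coset r n) (map (b_elem n) xs)" by simp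
  have S: "Q_scalars r n = Q_coset r n ` range zconst" by (auto simp: Q_scalars_def)
  have "zconst 1 \<notin> J_ideal r n"
  proof
    assume *: "zconst 1 \<in> J_ideal r n"
    have "(\<Sum>i\<in>index_pairs r n. zconst (of_bool (i = (id, {#}))) * b_elem n i) =
        (\<Sum>i\<in>index_pairs r n. if i = (id, {#}) then zconst 1 * b_elem n i else 0)"
      by (rule sum.cong) (simp_all add: zconst_def)
    also have "\<dots> = zconst 1 * b_elem n (id, {#})" using id_index[of r n] finite_index_pairs[of r n] by simp
    also have "\<dots> = zconst 1" by (simp add: b_elem_id)
    finally show False
      using b_elem_independent_mod_J[OF assms _ id_index, of "\<lambda>i. of_bool (i = (id, {#}))"] * by simp
  qed
  then have "Q_coset r n 1 \<noteq> \<zero>\<^bsub>Q_ring r n\<^esub>"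
    using Q_coset_zero_iff[OF T_one] by (simp add: zconst_def)
  then have one: "\<one>\<^bsub>Q_ring r n\<^esub> \<noteq> \<zero>\<^bsub>Q_ring r n\<^esub>" using h.hom_one by simp
  have K: "subfield (Q_scalars r n) (Q_ring r n)"
    unfolding S by (rule h.img_is_subfield(2)[OF constants_subfield one])
  have usQ: "set (map (Q_coset r n) (map (b_elem n) xs)) \<subseteq> carrier (Q_ring r n)"
    using usT by auto
  have lift: "\<exists>cs. ks = map (Q_coset r n) (map zconst cs)" if "set ks \<subseteq> Q_scalars r n" for ks
    using that
  proof (induction ks)
    case (Cons k ks)
    then obtain cs c where "ks = map (Q_coset r n) (map zconst cs)" "k = Q_coset r n (zconst c)"
      by (auto simp: Q_scalars_def)
    then show ?case by (intro exI[of _ "c # cs"]) simp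
  qed simp
  have comb: "h.combine (map (Q_coset r n) (map zconst cs)) (map (Q_coset r n) (map (b_elem n) xs)) =
      Q_coset r n (h.R.combine (map zconst cs) (map (b_elem n) xs))" for cs
    by (rule h.combine_hom) (use usT T_const in auto)
  have comb_T: "h.R.combine (map zconst cs) (map (b_elem n) xs) \<in> carrier (T_ring n)" for cs
    by (rule h.R.combine_in_carrier) (use usT T_const in auto)
  show "h.independent (Q_scalars r n) (map (\<lambda>i. Q_coset r n (b_elem n i)) xs)"
    unfolding eq
  proof (rule h.trivial_combine_imp_independent[OF K usQ])
    fix ks assume ks: "set ks \<subseteq> Q_scalars r n"
      "h.combine ks (map (Q_coset r n) (map (b_elem n) xs)) = \<zero>\<^bsub>Q_ring r n\<^esub>"
    \<comment> \<open>the coefficients, cut or padded with zeros to the length of the list of vectors\<close>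
    let ?ks = "take (length xs) ks @ replicate (length xs - length ks) \<zero>\<^bsub>Q_ring r n\<^esub>"
    show "set (take (length (map (Q_coset r n) (map (b_elem n) xs))) ks) \<subseteq> {\<zero>\<^bsub>Q_ring r n\<^esub>}"
    proof -
      have z: "\<zero>\<^bsub>Q_ring r n\<^esub> \<in> Q_scalars r n"
        using subringE(2)[OF subfieldE(1)[OF K]] .
      have "set ?ks \<subseteq> Q_scalars r n" using ks(1) z set_take_subset[of "length xs" ks] by (auto simp del: set_take_subset)
      then obtain cs where cs: "?ks = map (Q_coset r n) (map zconst cs)" using lift by blast
      have len: "length cs = length xs" using arg_cong[OF cs, of length] by simp
      have "h.combine ?ks (map (Q_coset r n) (map (b_elem n) xs)) = \<zero>\<^bsub>Q_ring r n\<^esub>"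
        using ks(2) h.combine_append_replicate[OF usQ] h.combine_take[of "map (Q_coset r n) (map (b_elem n) xs)" ks]
        by simp
      then have "h.R.combine (map zconst cs) (map (b_elem n) xs) \<in> J_ideal r n"
        unfolding cs comb using Q_coset_zero_iff[OF comb_T] by blast
      moreover obtain c where c: "cs = map c xs" using list_as_map[OF xs(1) len] by blast
      moreover have "h.R.combine (map zconst (map c xs)) (map (b_elem n) xs) = (\<Sum>x\<in>set xs. zconst (c x) * b_elem n x)"
        using combine_map_sum[OF xs(1) bT, where c = c] by (simp add: comp_def)
      ultimately have "c j = 0" if "j \<in> set xs" for j
        using b_elem_independent_mod_J[OF assms, of c j] that unfolding xs(2) by simp
      moreover have "Q_coset r n (zconst 0) = \<zero>\<^bsub>Q_ring r n\<^esub>"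
        using h.hom_zero by (simp add: zconst_def)
      ultimately have "set ?ks \<subseteq> {\<zero>\<^bsub>Q_ring r n\<^esub>}" unfolding cs c by auto
      then show ?thesis by simp
    qed
  qed
  show "h.Span (Q_scalars r n) (map (\<lambda>i. Q_coset r n (b_elem n i)) xs) = carrier (Q_ring r n)"
    unfolding eq
  proof (rule equalityI[OF h.Span_in_carrier[OF _ usQ]])
    show "Q_scalars r n \<subseteq> carrier (Q_ring r n)"
      using subringE(1)[OF subfieldE(1)[OF K]] .
    show "carrier (Q_ring r n) \<subseteq> h.Span (Q_scalars r n) (map (Q_coset r n) (map (b_elem n) xs))"
    proof
      fix y assume "y \<in> carrier (Q_ring r n)"
      then obtain p where p: "p \<in> carrier (T_ring n)" "y = Q_coset r n p"
        unfolding Q_coset_surj[symmetric] by blast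
      obtain c where c: "p - (\<Sum>i\<in>index_pairs r n. zconst (c i) * b_elem n i) \<in> J_ideal r n"
        using b_elem_spans_mod_J[OF assms p(1)] by blast
      let ?s = "h.R.combine (map zconst (map c xs)) (map (b_elem n) xs)"
      have s: "?s = (\<Sum>i\<in>index_pairs r n. zconst (c i) * b_elem n i)"
        using combine_map_sum[OF xs(1) bT, where c = c] by (simp add: xs(2) comp_def)
      have d: "p - ?s \<in> carrier (T_ring n)" by (rule T_diff[OF p(1) comb_T])
      have "y = Q_coset r n ((p - ?s) \<oplus>\<^bsub>T_ring n\<^esub> ?s)" by (simp add: p(2))
      also have "\<dots> = Q_coset r n (p - ?s) \<oplus>\<^bsub>Q_ring r n\<^esub> Q_coset r n ?s"
        by (rule h.hom_add[OF d comb_T])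
      also have "Q_coset r n (p - ?s) = \<zero>\<^bsub>Q_ring r n\<^esub>"
        by (subst Q_coset_zero_iff[OF d], subst s, rule c)
      also have "\<zero>\<^bsub>Q_ring r n\<^esub> \<oplus>\<^bsub>Q_ring r n\<^esub> Q_coset r n ?s = Q_coset r n ?s"
        by (rule h.S.l_zero[OF h.hom_closed[OF comb_T]])
      also have "\<dots> = h.combine (map (Q_coset r n) (map zconst (map c xs))) (map (Q_coset r n) (map (b_elem n) xs))"
        by (rule comb[symmetric])
      finally show "y \<in> h.Span (Q_scalars r n) (map (Q_coset r n) (map (b_elem n) xs))"
        unfolding h.Span_eq_combine_set[OF K usQ]
        by (intro CollectI exI conjI) (auto simp: Q_scalars_def)
    qed
  qed
qed

section \<open>Colored permutations\<close>

lemma omega_pow_inj: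
  assumes "r \<ge> 1" "c < r" "d < r" "omega r ^ c = omega r ^ d"
  shows "c = d"
proof -
  have *: "omega r ^ k = exp (2 * of_real pi * \<i> * of_nat k / of_nat r)" for k
    by (simp add: omega_def exp_of_nat_mult[symmetric] algebra_simps)
  have "cis (2 * pi * real c / real r) = cis (2 * pi * real d / real r)"
    using assms(4) by (simp add: * cis_conv_exp algebra_simps)
  moreover have "inj_on (\<lambda>k. cis (2 * pi * real k / real r)) {..<r}"
    using bij_betw_imp_inj_on[OF bij_betw_roots_unity[of r]] assms(1) by simp
  ultimately show ?thesis using assms(2,3) by (auto dest: inj_onD)
qed

lemma omega_pow_r: "r \<ge> 1 \<Longrightarrow> omega r ^ r = 1"
  by (simp add: omega_def exp_of_nat_mult[symmetric])

lemma omega_pow_mod: "r \<ge> 1 \<Longrightarrow> omega r ^ (k mod r) = omega r ^ k"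
proof -
  assume r: "r \<ge> 1"
  have "omega r ^ k = omega r ^ (r * (k div r) + k mod r)" by simp
  also have "\<dots> = omega r ^ (k mod r)" by (simp only: power_add power_mult omega_pow_r[OF r]) simp
  finally show ?thesis by simp
qed

lemma color_eqI:
  assumes "r \<ge> 1" "c < r" "snd g j = omega r ^ c"
  shows "color r g j = c"
  unfolding color_def
  by (rule the_equality) (use assms omega_pow_inj in auto)

lemma colperms_simps [simp]:
  "(\<pi>, \<epsilon>) \<in> carrier (colperms r n) \<longleftrightarrow> \<pi> permutes {1..n} \<and>
     (\<forall>j\<in>{1..n}. \<exists>c<r. \<epsilon> j = omega r ^ c) \<and> (\<forall>j. j \<notin> {1..n} \<longrightarrow> \<epsilon> j = 1)"
  "(\<pi>', \<epsilon>') \<otimes>\<^bsub>colperms r n\<^esub> (\<pi>, \<epsilon>) = (\<pi>' \<circ> \<pi>, \<lambda>j. \<epsilon> j * \<epsilon>' (\<pi> j))"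
  "\<one>\<^bsub>colperms r n\<^esub> = (id, \<lambda>_. 1)"
  by (simp_all add: colperms_def)

lemma colpermsD:
  assumes "g \<in> carrier (colperms r n)"
  shows "fst g permutes {1..n}"
    and "j \<in> {1..n} \<Longrightarrow> \<exists>c<r. snd g j = omega r ^ c"
    and "j \<notin> {1..n} \<Longrightarrow> snd g j = 1"
  using assms unfolding colperms_def by (auto simp only: partial_object.simps mem_Collect_eq case_prod_beta)

lemma color_spec:
  assumes "r \<ge> 1" "g \<in> carrier (colperms r n)" "j \<in> {1..n}"
  shows "color r g j < r" "snd g j = omega r ^ color r g j"
proof -
  obtain c where "c < r" "snd g j = omega r ^ c"
    using colpermsD(2)[OF assms(2,3)] by blast
  then show "color r g j < r" "snd g j = omega r ^ color r g j"
    using color_eqI[OF assms(1)] by auto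
qed

lemma omega_nonzero: "omega r \<noteq> 0"
  by (simp add: omega_def)

definition col_inverse :: "colperm \<Rightarrow> colperm" where
  "col_inverse g = (inv_into UNIV (fst g), \<lambda>j. inverse (snd g (inv_into UNIV (fst g) j)))"

lemma omega_inverse:
  assumes "r \<ge> 1" "c < r"
  shows "inverse (omega r ^ c) = omega r ^ ((r - c) mod r)"
proof -
  have "omega r ^ c * omega r ^ ((r - c) mod r) = 1"
    unfolding omega_pow_mod[OF assms(1)]
    using assms by (simp add: power_add[symmetric] omega_pow_r)
  then show ?thesis by (rule inverse_unique)
qed

lemma col_inverse_closed:
  assumes "r \<ge> 1" "g \<in> carrier (colperms r n)"
  shows "col_inverse g \<in> carrier (colperms r n)"
proof -
  obtain \<pi> \<epsilon> where g: "g = (\<pi>, \<epsilon>)" by (cases g)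
  have p: "\<pi> permutes {1..n}" using assms(2) by (simp add: g)
  have q: "inv_into UNIV \<pi> permutes {1..n}" by (rule permutes_inv[OF p])
  have "\<exists>d<r. inverse (\<epsilon> (inv_into UNIV \<pi> j)) = omega r ^ d" if "j \<in> {1..n}" for j
  proof -
    have "inv_into UNIV \<pi> j \<in> {1..n}" using that permutes_in_image[OF q] by blast
    then obtain c where "c < r" "\<epsilon> (inv_into UNIV \<pi> j) = omega r ^ c" using colpermsD(2)[OF assms(2)] unfolding g snd_conv by blast
    then show ?thesis
      using omega_inverse[OF assms(1)] assms(1) by (intro exI[of _ "(r - c) mod r"]) simp
  qed
  moreover have "inverse (\<epsilon> (inv_into UNIV \<pi> j)) = 1" if "j \<notin> {1..n}" for j
    using that assms(2) permutes_not_in[OF q that] by (simp add: g)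
  ultimately show ?thesis using q by (simp add: g col_inverse_def)
qed

lemma colperms_inv:
  assumes "r \<ge> 1" "g \<in> carrier (colperms r n)"
  shows "inv\<^bsub>colperms r n\<^esub> g = col_inverse g"
proof -
  obtain \<pi> \<epsilon> where g: "g = (\<pi>, \<epsilon>)" by (cases g)
  have p: "\<pi> permutes {1..n}" using assms(2) by (simp add: g)
  have nz: "\<epsilon> j \<noteq> 0" for j
    using colpermsD(2,3)[OF assms(2), of j] omega_nonzero[of r] by (cases "j \<in> {1..n}") (auto simp: g)
  let ?G = "colperms r n"
  have 1: "col_inverse g \<otimes>\<^bsub>?G\<^esub> g = \<one>\<^bsub>?G\<^esub>" "g \<otimes>\<^bsub>?G\<^esub> col_inverse g = \<one>\<^bsub>?G\<^esub>"
    using permutes_inverses[OF p] nz by (auto simp: g col_inverse_def fun_eq_iff)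
  have 2: "y = col_inverse g" if "g \<otimes>\<^bsub>?G\<^esub> y = \<one>\<^bsub>?G\<^esub>" "y \<otimes>\<^bsub>?G\<^esub> g = \<one>\<^bsub>?G\<^esub>" for y
  proof -
    obtain \<tau> \<delta> where y: "y = (\<tau>, \<delta>)" by (cases y)
    have a: "\<pi> \<circ> \<tau> = id" "\<And>j. \<delta> j * \<epsilon> (\<tau> j) = 1"
      using that(1) by (auto simp: g y fun_eq_iff)
    have t: "\<tau> = inv_into UNIV \<pi>"
    proof
      fix j
      have "\<pi> (\<tau> j) = j" using fun_cong[OF a(1), of j] by simp
      then show "\<tau> j = inv_into UNIV \<pi> j" using permutes_inverses(2)[OF p, of "\<tau> j"] by simp
    qed
    have "\<delta> = (\<lambda>j. inverse (\<epsilon> (\<tau> j)))"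
    proof
      fix j
      have "\<epsilon> (\<tau> j) * \<delta> j = 1" using a(2)[of j] by (simp only: mult.commute)
      then show "\<delta> j = inverse (\<epsilon> (\<tau> j))" by (rule inverse_unique[symmetric])
    qed
    then show ?thesis unfolding y g col_inverse_def fst_conv snd_conv t[symmetric] by simp
  qed
  show ?thesis unfolding m_inv_def
    by (rule the_equality) (use 1 2 col_inverse_closed[OF assms] in blast)+
qed

lemma color_inverse:
  assumes "r \<ge> 1" "g \<in> carrier (colperms r n)" "i \<in> {1..n}"
  shows "color r (inv\<^bsub>colperms r n\<^esub> g) (fst g i) = (r - color r g i) mod r"
proof (rule color_eqI[OF assms(1)])
  obtain \<pi> \<epsilon> where g: "g = (\<pi>, \<epsilon>)" by (cases g)
  have p: "\<pi> permutes {1..n}" using assms(2) by (simp add: g)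
  show "snd (inv\<^bsub>colperms r n\<^esub> g) (fst g i) = omega r ^ ((r - color r g i) mod r)"
    using color_spec[OF assms] permutes_inverses(2)[OF p]
    unfolding colperms_inv[OF assms(1,2)] by (simp add: col_inverse_def g omega_inverse[OF assms(1)])
qed (use assms(1) in simp)

lemma count_NNeg: "count (NNeg r n g) i = (if i \<in> {1..n} then color r g i else 0)"
  by (simp add: NNeg_def count_sum if_distrib cong: if_cong)

lemma letter_less_key:
  assumes "j \<in> {1..n}" "k \<in> {1..n}"
  shows "letter_less (j, c) (k, d) \<longleftrightarrow> (n + 1) * d + (n + 1 - k) < (n + 1) * c + (n + 1 - j)"
  by (subst lex_less_iff) (use assms in \<open>auto simp: letter_less_def\<close>)

text \<open>
  The colored letters of \<open>g\<close> increase where this rank falls.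
\<close>

definition letter_rank :: "nat \<Rightarrow> nat \<Rightarrow> colperm \<Rightarrow> nat \<Rightarrow> nat" where
  "letter_rank r n g j = (n + 1) * color r g j + (n + 1 - fst g j)"

lemma letter_rank_inj:
  assumes "g \<in> carrier (colperms r n)"
  shows "inj_on (letter_rank r n g) {1..n}"
proof (rule inj_onI)
  have p: "fst g permutes {1..n}" using assms by (cases g) simp
  fix i j assume ij: "i \<in> {1..n}" "j \<in> {1..n}" "letter_rank r n g i = letter_rank r n g j"
  have m: "fst g i \<in> {1..n}" "fst g j \<in> {1..n}"
    using ij permutes_in_image[OF p] by blast+
  have "\<not> letter_less (fst g i, color r g i) (fst g j, color r g j)"
    "\<not> letter_less (fst g j, color r g j) (fst g i, color r g i)"
    using ij(3) letter_less_key[OF m] letter_less_key[OF m(2,1)] by (simp_all add: letter_rank_def)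
  then have "fst g i = fst g j" by (auto simp: letter_less_def)
  then show "i = j" using permutes_inj[OF p] by (simp add: inj_eq)
qed

lemma Des_A_rank:
  assumes "g \<in> carrier (colperms r n)"
  shows "i \<in> Des_A r n g \<longleftrightarrow> i \<in> {1..<n} \<and> letter_rank r n g i < letter_rank r n g (i + 1)"
proof -
  have p: "fst g permutes {1..n}" using assms by (cases g) simp
  show ?thesis
  proof (cases "i \<in> {1..<n}")
    case True
    then have "i \<in> {1..n}" "i + 1 \<in> {1..n}" by auto
    then have m: "fst g i \<in> {1..n}" "fst g (i + 1) \<in> {1..n}"
      using permutes_in_image[OF p] by blast+
    then show ?thesis
      using letter_less_key[OF m(2,1)] True by (auto simp: Des_A_def letter_rank_def)
  qed (auto simp: Des_A_def)
qed

lemma Des_A_empty_iff: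
  assumes "h \<in> carrier (colperms r n)"
  shows "Des_A r n h = {} \<longleftrightarrow> sorts n (letter_rank r n h) id"
proof -
  have ne: "letter_rank r n h i \<noteq> letter_rank r n h (i + 1)" if "i \<in> {1..<n}" for i
    using inj_onD[OF letter_rank_inj[OF assms], of i "i + 1"] that by auto
  have "Des_A r n h = {} \<longleftrightarrow> (\<forall>i\<in>{1..<n}. \<not> letter_rank r n h i < letter_rank r n h (i + 1))"
    unfolding set_eq_iff Des_A_rank[OF assms] by auto
  also have "\<dots> \<longleftrightarrow> (\<forall>i\<in>{1..<n}. letter_rank r n h (i + 1) < letter_rank r n h i)"
  proof (rule ball_cong[OF refl])
    fix i assume "i \<in> {1..<n}"
    then show "\<not> letter_rank r n h i < letter_rank r n h (i + 1) \<longleftrightarrow>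
        letter_rank r n h (i + 1) < letter_rank r n h i"
      using ne[of i] by linarith
  qed
  finally show ?thesis by (simp add: sorts_def permutes_id)
qed

lemma letter_rank_compose:
  assumes "r \<ge> 1" "h \<in> carrier (colperms r n)" "\<sigma> permutes {1..n}" "j \<in> {1..n}"
  shows "letter_rank r n (h \<otimes>\<^bsub>colperms r n\<^esub> (\<sigma>, \<lambda>_. 1)) j = letter_rank r n h (\<sigma> j)"
proof -
  have m: "\<sigma> j \<in> {1..n}" using permutes_in_image[OF assms(3)] assms(4) by blast
  obtain \<rho> \<delta> where h: "h = (\<rho>, \<delta>)" by (cases h)
  have "color r (h \<otimes>\<^bsub>colperms r n\<^esub> (\<sigma>, \<lambda>_. 1)) j = color r h (\<sigma> j)"
    using color_spec[OF assms(1,2) m] by (intro color_eqI[OF assms(1)]) (simp_all add: h)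
  then show ?thesis by (simp add: letter_rank_def h)
qed

text \<open>
  In \<open>g = h \<circ> \<sigma>\<close> the letter of \<open>g\<close> at position \<open>j\<close> is the letter of \<open>h\<close> at position \<open>\<sigma> j\<close>. So \<open>h\<close> lists
  the letters of \<open>g\<close> in the order \<open>\<sigma>\<^sup>-\<^sup>1\<close>, and it has no descents exactly if \<open>\<sigma>\<^sup>-\<^sup>1\<close> sorts them.
\<close>

lemma sorting_factor_iff:
  assumes "r \<ge> 1" "g \<in> carrier (colperms r n)"
  shows "sorting_factor r n g \<sigma> \<longleftrightarrow>
    \<sigma> permutes {1..n} \<and> sorts n (letter_rank r n g) (inv_into UNIV \<sigma>)"
proof (cases "\<sigma> permutes {1..n}")
  case True
  note p = True
  let ?\<tau> = "inv_into UNIV \<sigma>"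
  have t: "?\<tau> permutes {1..n}" by (rule permutes_inv[OF p])
  obtain \<pi> \<epsilon> where g: "g = (\<pi>, \<epsilon>)" by (cases g)
  let ?h = "g \<otimes>\<^bsub>colperms r n\<^esub> (?\<tau>, \<lambda>_. 1)"
  have hc: "?h \<in> carrier (colperms r n)"
  proof -
    have "\<forall>j\<in>{1..n}. \<exists>c<r. \<epsilon> (?\<tau> j) = omega r ^ c"
    proof
      fix j assume "j \<in> {1..n}"
      then have "?\<tau> j \<in> {1..n}" using permutes_in_image[OF t] by blast
      then show "\<exists>c<r. \<epsilon> (?\<tau> j) = omega r ^ c" using assms(2) by (simp add: g)
    qed
    moreover have "\<epsilon> (?\<tau> j) = 1" if "j \<notin> {1..n}" for j
      using that permutes_not_in[OF t that] assms(2) by (simp add: g)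
    ultimately show ?thesis using assms(2) permutes_compose[OF t] by (simp add: g)
  qed
  have h_eq: "g = ?h \<otimes>\<^bsub>colperms r n\<^esub> (\<sigma>, \<lambda>_. 1)"
    using permutes_inverses[OF p] by (simp add: g fun_eq_iff)
  have uniq: "h = ?h" if "g = h \<otimes>\<^bsub>colperms r n\<^esub> (\<sigma>, \<lambda>_. 1)" for h
    using that permutes_inverses[OF p] by (cases h) (simp add: g fun_eq_iff)
  have "sorting_factor r n g \<sigma> \<longleftrightarrow> Des_A r n ?h = {}"
    unfolding sorting_factor_def using p hc h_eq uniq by metis
  also have "\<dots> \<longleftrightarrow> sorts n (letter_rank r n ?h) id" by (rule Des_A_empty_iff[OF hc])
  also have "\<dots> \<longleftrightarrow> sorts n (letter_rank r n g) ?\<tau>"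
    unfolding sorts_def using t
    by (simp add: letter_rank_compose[OF assms t] permutes_id)
  finally show ?thesis using p by simp
qed (simp add: sorting_factor_def)

lemma sorting_factor_unique:
  assumes "r \<ge> 1" "g \<in> carrier (colperms r n)"
  shows "\<exists>!\<sigma>. sorting_factor r n g \<sigma>"
proof (rule ex_ex1I)
  obtain \<tau> where t: "sorts n (letter_rank r n g) \<tau>"
    using sorts_exists[OF letter_rank_inj[OF assms(2)]] by blast
  then have p: "\<tau> permutes {1..n}" by (simp add: sorts_def)
  have "sorting_factor r n g (inv_into UNIV \<tau>)"
    unfolding sorting_factor_iff[OF assms]
    using permutes_inv[OF p] t permutes_inv_inv[OF p] by simp
  then show "\<exists>\<sigma>. sorting_factor r n g \<sigma>" by blast
next
  fix \<sigma> \<sigma>' assume s: "sorting_factor r n g \<sigma>" "sorting_factor r n g \<sigma>'"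
  then have "inv_into UNIV \<sigma> = inv_into UNIV \<sigma>'"
    unfolding sorting_factor_iff[OF assms]
    by (intro sorts_unique[OF letter_rank_inj[OF assms(2)]]) auto
  then show "\<sigma> = \<sigma>'"
    using s permutes_inv_inv unfolding sorting_factor_iff[OF assms] by metis
qed

definition sorting_perm :: "nat \<Rightarrow> nat \<Rightarrow> colperm \<Rightarrow> nat \<Rightarrow> nat" where
  "sorting_perm r n g = (THE \<sigma>. sorting_factor r n g \<sigma>)"

lemma sorting_perm:
  assumes "r \<ge> 1" "g \<in> carrier (colperms r n)"
  shows "sorting_factor r n g (sorting_perm r n g)"
  unfolding sorting_perm_def by (rule theI'[OF sorting_factor_unique[OF assms]])

lemma sorting_perm_eq:
  assumes "r \<ge> 1" "g \<in> carrier (colperms r n)" "sorting_factor r n g \<sigma>"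
  shows "sorting_perm r n g = \<sigma>"
  using sorting_factor_unique[OF assms(1,2)] sorting_perm[OF assms(1,2)] assms(3) by blast

text \<open>
  The permutation \<open>\<sigma>\<close> is the standardization of the word of colored letters of \<open>g\<close>, and hence has the
  same descents.
\<close>

lemma Des_sorting_perm:
  assumes "r \<ge> 1" "g \<in> carrier (colperms r n)"
  shows "Des n (sorting_perm r n g) = Des_A r n g"
proof -
  let ?\<sigma> = "sorting_perm r n g"
  have p: "?\<sigma> permutes {1..n}" and s: "sorts n (letter_rank r n g) (inv_into UNIV ?\<sigma>)"
    using sorting_perm[OF assms] unfolding sorting_factor_iff[OF assms] by auto
  have "letter_rank r n g j < letter_rank r n g i \<longleftrightarrow> ?\<sigma> i < ?\<sigma> j" if "i \<in> {1..n}" "j \<in> {1..n}" for i j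
  proof -
    have "?\<sigma> i \<in> {1..n}" "?\<sigma> j \<in> {1..n}" using that permutes_in_image[OF p] by blast+
    from sorts_less_iff[OF s this] show ?thesis by (simp add: permutes_inverses(2)[OF p])
  qed
  then show ?thesis
    using Des_A_rank[OF assms(2)] by (fastforce simp: Des_def)
qed

lemma index_of_eq: "index_of r n g = (sorting_perm r n g, NNeg r n (inv\<^bsub>colperms r n\<^esub> g))"
  by (simp add: index_of_def sorting_perm_def)

lemma index_of_in:
  assumes "r \<ge> 1" "g \<in> carrier (colperms r n)"
  shows "index_of r n g \<in> index_pairs r n"
proof -
  have i: "inv\<^bsub>colperms r n\<^esub> g \<in> carrier (colperms r n)"
    using col_inverse_closed[OF assms] by (simp add: colperms_inv[OF assms])
  have "count (NNeg r n (inv\<^bsub>colperms r n\<^esub> g)) j \<le> r - 1" for j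
    using color_spec(1)[OF assms(1) i, of j] by (auto simp: count_NNeg)
  moreover have "set_mset (NNeg r n (inv\<^bsub>colperms r n\<^esub> g)) \<subseteq> {1..n}"
    by (auto simp: set_mset_def count_NNeg split: if_splits)
  ultimately show ?thesis
    using sorting_perm[OF assms] by (simp add: index_of_eq index_pairs_def sorting_factor_def)
qed

lemma neg_mod_inj:
  assumes "(c::nat) < r" "d < r" "(r - c) mod r = (r - d) mod r"
  shows "c = d"
  using assms by (cases "c = 0"; cases "d = 0") auto

text \<open>
  The multiset of \<open>g\<close> determines which color each letter \<open>a\<close> carries. If \<open>g\<close> and \<open>g'\<close> carry the same
  letters, a permutation \<open>\<tau>\<close> of the positions matches equal letters. It transforms a sorting of \<open>g\<close> into
  a sorting of \<open>g'\<close>; as both are sorted by the same permutation, \<open>\<tau>\<close> is the identity.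
\<close>

lemma index_of_inj:
  assumes "r \<ge> 1"
  shows "inj_on (index_of r n) (carrier (colperms r n))"
proof (rule inj_onI)
  fix g g' assume g: "g \<in> carrier (colperms r n)" "g' \<in> carrier (colperms r n)"
    and eq: "index_of r n g = index_of r n g'"
  let ?\<sigma> = "sorting_perm r n g"
  have p: "?\<sigma> permutes {1..n}" using sorting_perm[OF assms g(1)] by (simp add: sorting_factor_def)
  have pg: "fst g permutes {1..n}" "fst g' permutes {1..n}" using g by (cases g; cases g'; simp)+
  have s: "sorting_perm r n g' = ?\<sigma>" and N: "NNeg r n (inv\<^bsub>colperms r n\<^esub> g) = NNeg r n (inv\<^bsub>colperms r n\<^esub> g')"
    using eq by (auto simp: index_of_eq)
  have letter: "color r g i = color r g' i'" if "i \<in> {1..n}" "i' \<in> {1..n}" "fst g i = fst g' i'" for i i'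
  proof -
    have m: "fst g i \<in> {1..n}" using that permutes_in_image[OF pg(1)] by blast
    have "(r - color r g i) mod r = (r - color r g' i') mod r"
      using arg_cong[OF N, of "\<lambda>M. count M (fst g i)"] m that(3)
        color_inverse[OF assms g(1) that(1)] color_inverse[OF assms g(2) that(2)]
      by (simp add: count_NNeg)
    then show ?thesis
      by (rule neg_mod_inj[OF color_spec(1)[OF assms g(1) that(1)] color_spec(1)[OF assms g(2) that(2)]])
  qed
  let ?\<tau> = "inv_into UNIV (fst g') \<circ> fst g"
  have t: "?\<tau> permutes {1..n}" by (rule permutes_compose[OF pg(1) permutes_inv[OF pg(2)]])
  have gt: "fst g' (?\<tau> i) = fst g i" for i using permutes_inverses(1)[OF pg(2)] by simp
  have rank: "letter_rank r n g' (?\<tau> i) = letter_rank r n g i" if "i \<in> {1..n}" for i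
  proof -
    have "?\<tau> i \<in> {1..n}" using that permutes_in_image[OF t] by blast
    then show ?thesis using letter[OF that _ gt[symmetric]] unfolding letter_rank_def gt by simp
  qed
  have s1: "sorts n (letter_rank r n g) (inv_into UNIV ?\<sigma>)" "sorts n (letter_rank r n g') (inv_into UNIV ?\<sigma>)"
    using sorting_perm[OF assms g(1)] sorting_perm[OF assms g(2)] s
    unfolding sorting_factor_iff[OF assms g(1)] sorting_factor_iff[OF assms g(2)] by auto
  let ?s = "inv_into UNIV ?\<sigma>"
  have ps: "?s permutes {1..n}" by (rule permutes_inv[OF p])
  have in_s: "?s i \<in> {1..n}" if "i \<in> {1..n}" for i using that permutes_in_image[OF ps] by blast
  have "sorts n (letter_rank r n g') (?\<tau> \<circ> ?s)"
    unfolding sorts_def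
  proof (intro conjI ballI)
    fix i assume i: "i \<in> {1..<n}"
    then have "i \<in> {1..n}" "i + 1 \<in> {1..n}" by simp_all
    then have "?s i \<in> {1..n}" "?s (i + 1) \<in> {1..n}" by (blast intro: in_s)+
    then show "letter_rank r n g' ((?\<tau> \<circ> ?s) (i + 1)) < letter_rank r n g' ((?\<tau> \<circ> ?s) i)"
      using s1(1) i unfolding sorts_def comp_apply[of ?\<tau> ?s] by (simp only: rank)
  qed (rule permutes_compose[OF ps t])
  then have "?\<tau> \<circ> ?s = ?s" by (rule sorts_unique[OF letter_rank_inj[OF g(2)] _ s1(2)])
  then have "?\<tau> i = i" for i
    using permutes_inverses(2)[OF p, of i] by (metis comp_apply)
  then have f: "fst g i = fst g' i" for i using gt[of i] by simp
  have "snd g i = snd g' i" for i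
  proof (cases "i \<in> {1..n}")
    case True
    then show ?thesis using letter[OF True True f] color_spec(2)[OF assms g(1) True] color_spec(2)[OF assms g(2) True] by simp
  next
    case False
    then show ?thesis using g by (cases g; cases g') simp
  qed
  with f show "g = g'" by (simp add: prod_eq_iff fun_eq_iff)
qed

text \<open>
  The colors of the letters are read off from \<open>X\<close>. Sorting the colored letters gives \<open>h\<close> without
  descents, and \<open>g = h \<circ> \<sigma>\<close> is as required.
\<close>

lemma index_of_surj:
  assumes "r \<ge> 1" "(\<sigma>, X) \<in> index_pairs r n"
  shows "(\<sigma>, X) \<in> index_of r n ` carrier (colperms r n)"
proof -
  have p: "\<sigma> permutes {1..n}" and X: "set_mset X \<subseteq> {1..n}" "\<And>j. count X j \<le> r - 1"
    using assms(2) by (auto simp: index_pairs_def)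
  define col where "col a = (r - count X a) mod r" for a
  have col: "col a < r" for a using assms(1) by (simp add: col_def)
  obtain \<rho> where rho: "sorts n (letter_key n col) \<rho>" using sorts_exists[OF letter_key_inj] by blast
  then have pr: "\<rho> permutes {1..n}" by (simp add: sorts_def)
  define h where "h = (\<rho>, \<lambda>j. if j \<in> {1..n} then omega r ^ col (\<rho> j) else 1)"
  have hc: "h \<in> carrier (colperms r n)" using pr col by (auto simp: h_def)
  have hcol: "color r h j = col (\<rho> j)" if "j \<in> {1..n}" for j
    using that by (intro color_eqI[OF assms(1) col]) (simp add: h_def)
  have "Des_A r n h = {}"
    unfolding Des_A_empty_iff[OF hc] sorts_def
  proof (intro conjI ballI)
    fix i assume i: "i \<in> {1..<n}"
    then have "letter_key n col (\<rho> (i + 1)) < letter_key n col (\<rho> i)" using rho by (simp add: sorts_def)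
    moreover have "i \<in> {1..n}" "i + 1 \<in> {1..n}" using i by auto
    ultimately show "letter_rank r n h (id (i + 1)) < letter_rank r n h (id i)"
      using hcol by (simp add: letter_rank_def letter_key_def h_def)
  qed (rule permutes_id)
  define g where "g = h \<otimes>\<^bsub>colperms r n\<^esub> (\<sigma>, \<lambda>_. 1)"
  have in_s: "\<sigma> j \<in> {1..n} \<longleftrightarrow> j \<in> {1..n}" for j by (rule permutes_in_image[OF p])
  have g_eq: "g = (\<rho> \<circ> \<sigma>, \<lambda>j. if j \<in> {1..n} then omega r ^ col (\<rho> (\<sigma> j)) else 1)"
    unfolding g_def h_def colperms_simps(2) in_s by simp
  have gc: "g \<in> carrier (colperms r n)"
    using permutes_compose[OF p pr] col by (auto simp: g_eq)
  have "sorting_factor r n g \<sigma>"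
    unfolding sorting_factor_def using p hc \<open>Des_A r n h = {}\<close> g_def by blast
  then have 1: "sorting_perm r n g = \<sigma>" by (rule sorting_perm_eq[OF assms(1) gc])
  have "NNeg r n (inv\<^bsub>colperms r n\<^esub> g) = X"
  proof (rule multiset_eqI)
    fix a
    show "count (NNeg r n (inv\<^bsub>colperms r n\<^esub> g)) a = count X a"
    proof (cases "a \<in> {1..n}")
      case True
      have "a \<in> fst g ` {1..n}"
        using True permutes_image[OF permutes_compose[OF p pr]] by (simp add: g_eq)
      then obtain i where i: "i \<in> {1..n}" "a = fst g i" by blast
      have "color r g i = col a"
        using i by (intro color_eqI[OF assms(1) col]) (simp add: g_eq)
      then have "count (NNeg r n (inv\<^bsub>colperms r n\<^esub> g)) a = (r - col a) mod r"
        using True i color_inverse[OF assms(1) gc i(1)] by (simp add: count_NNeg)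
      moreover have "count X a < r" using X(2)[of a] assms(1) by linarith
      ultimately show ?thesis by (cases "count X a = 0") (auto simp: col_def)
    next
      case False
      then have "a \<notin># X" using X(1) by blast
      then show ?thesis unfolding count_NNeg if_not_P[OF False] by (simp add: not_in_iff)
    qed
  qed
  then have "index_of r n g = (\<sigma>, X)" by (simp add: index_of_eq 1)
  then show ?thesis using gc by (metis imageI)
qed

theorem index_of_bij:
  assumes "r \<ge> 1"
  shows "bij_betw (index_of r n) (carrier (colperms r n)) (index_pairs r n)"
  unfolding bij_betw_def
  using index_of_inj[OF assms] index_of_in[OF assms] index_of_surj[OF assms] by auto

lemma bidegree_superset:
  assumes "finite S" "Poly_Mapping.keys m \<subseteq> S"
  shows "bidegree m = (\<Sum>A\<in>S. Poly_Mapping.lookup m A, \<Sum>A\<in>S. Poly_Mapping.lookup m A * card A)"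
proof -
  have "(\<Sum>A\<in>Poly_Mapping.keys m. Poly_Mapping.lookup m A) = (\<Sum>A\<in>S. Poly_Mapping.lookup m A)"
    "(\<Sum>A\<in>Poly_Mapping.keys m. Poly_Mapping.lookup m A * card A) = (\<Sum>A\<in>S. Poly_Mapping.lookup m A * card A)"
    by (rule sum.mono_neutral_left; use assms in \<open>auto simp: in_keys_iff\<close>)+
  then show ?thesis by (simp add: bidegree_def)
qed

lemma bidegree_add_single:
  "bidegree (Poly_Mapping.single A 1 + m) = (1 + fst (bidegree m), card A + snd (bidegree m))"
proof -
  let ?S = "insert A (Poly_Mapping.keys m)"
  have k: "Poly_Mapping.keys (Poly_Mapping.single A 1 + m) \<subseteq> ?S"
    using keys_add[of "Poly_Mapping.single A (1::nat)" m] by auto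
  have l: "Poly_Mapping.lookup (Poly_Mapping.single A 1 + m) B = (if B = A then 1 else 0) + Poly_Mapping.lookup m B" for B
    by (simp add: lookup_add lookup_single when_def)
  have fin: "finite ?S" by simp
  have "(\<Sum>B\<in>?S. (if B = A then 1 else 0) * card B) = (\<Sum>B\<in>?S. if B = A then card B else 0)"
    by (rule sum.cong) auto
  then have "(\<Sum>B\<in>?S. (if B = A then 1 else 0) * card B) = card A" using sum.delta[OF fin, of A card] by simp
  then show ?thesis
    unfolding bidegree_superset[OF fin k] bidegree_superset[OF fin subset_insertI] l distrib_right sum.distrib
    using sum.delta[OF fin, of A "\<lambda>_. 1"] by simp
qed

lemma bidegree_sum_mset:
  "bidegree (\<Sum>A\<in>#M. Poly_Mapping.single A 1) = (size M, \<Sum>A\<in>#M. card A)"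
proof (induction M)
  case empty
  show ?case by (simp add: bidegree_def)
next
  case (add A M)
  then show ?case using bidegree_add_single[of A "\<Sum>A\<in>#M. Poly_Mapping.single A 1"] by simp
qed

text \<open>
  The multiset of the prefix lengths occurring in \<open>b\<close> is \<open>Des \<sigma> + X\<close>, which is \<open>NDes g\<close>.
\<close>

theorem b_elem_bidegree:
  assumes "r \<ge> 1" "g \<in> carrier (colperms r n)"
  shows "\<exists>m. b_elem n (index_of r n g) = Poly_Mapping.single m 1 \<and> bidegree m = (ndes r n g, nmajor r n g)"
proof -
  let ?\<sigma> = "sorting_perm r n g" and ?N = "NDes r n g"
  have p: "?\<sigma> permutes {1..n}" using sorting_perm[OF assms] by (simp add: sorting_factor_def)
  let ?M = "image_mset (\<lambda>j. ?\<sigma> ` {1..j}) ?N"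
  have "b_elem n (index_of r n g) = zmon ?M"
    unfolding index_of_eq b_elem_zmon Des_sorting_perm[OF assms] NDes_def ..
  then have "b_elem n (index_of r n g) = Poly_Mapping.single (\<Sum>A\<in>#?M. Poly_Mapping.single A 1) 1"
    unfolding zmon_eq_single .
  moreover have "(\<Sum>A\<in>#?M. card A) = (\<Sum>j\<in>#?N. j)"
    using permutes_inj_on[OF p] by (simp add: image_mset.compositionality comp_def card_image)
  ultimately show ?thesis
    unfolding ndes_def nmajor_def using bidegree_sum_mset[of ?M] by (metis size_image_mset)
qed

theorem theorem1p4:
  fixes r n :: nat
  assumes "r \<ge> 1" and "n \<ge> 1"
  shows "is_basis_family (Q_ring r n) (Q_scalars r n) (index_pairs r n)
           (\<lambda>i. Q_coset r n (b_elem n i))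
    \<and> (\<exists>h \<in> ring_iso (Q_ring r n) (T_ring n Quot J_ideal r n).
          \<forall>p \<in> carrier (T_ring n). h (Q_coset r n p) = J_ideal r n +>\<^bsub>T_ring n\<^esub> p)
    \<and> (\<forall>g \<in> carrier (colperms r n). \<exists>!\<sigma>. sorting_factor r n g \<sigma>)
    \<and> bij_betw (index_of r n) (carrier (colperms r n)) (index_pairs r n)
    \<and> (\<forall>g \<in> carrier (colperms r n). \<exists>m.
          b_elem n (index_of r n g) = Poly_Mapping.single m 1
          \<and> bidegree m = (ndes r n g, nmajor r n g))"
  using b_elem_basis[OF assms] iterated_quotient_iso[of r n] sorting_factor_unique[OF assms(1)]
    index_of_bij[OF assms(1)] b_elem_bidegree[OF assms(1)]
  by (intro conjI ballI) auto

end
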